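(* Let $k\ge 0$ and let $L$ be a $k$-DCFL. Then there is a number $n$ such that every word $w\in L$ with $|w|>n$ can be written as $$w=s_0\,y_1u_1z_1\,s_1\,y_2u_2z_2\,s_2\cdots y_lu_lz_l\,s_l$$ for some $l\le k+1$ and words $s_i,y_i,u_i,z_i\in\Sigma^*$, such that: (1) $|y_1z_1\cdots y_lz_l|>0$; (2) $|y_1u_1z_1\cdots y_lu_lz_l|\le n$; (3) for every natural number $p$, the word $s_0y_1^pu_1z_1^ps_1\cdots y_l^pu_lz_l^ps_l$ belongs to $L$.
   Context: Let $\Sigma$ be a finite alphabet and $1\notin\Sigma$ a distinguished separator; $\Sigma_1=\Sigma\cup\{1\}$. The rank of $w\in\Sigma_1^*$ is $\mathrm{rk}(w)=|w|_1$. For $u,v\in\Sigma_1^*$ with $\mathrm{rk}(u)\ge j$, the $j$-th intercalation $u\odot_j v$ is the word obtained from $u$ by replacing the $j$-th occurrence of $1$ by $v$. Let $N$ be a finite set of nonterminals with a rank function $\mathrm{rk}:N\to\{0,\dots,k\}$. The set $Tm_k$ of $k$-correct terms, each with a rank, is the smallest set such that: each $A\in N$ is a term of rank $\mathrm{rk}(A)$; each $w\in\Sigma^*$ is a term of rank $0$; $1$ is a term of rank $1$; if $\alpha,\beta\in Tm_k$ and $\mathrm{rk}(\alpha)+\mathrm{rk}(\beta)\le k$ then $(\alpha\cdot\beta)$ is a term of rank $\mathrm{rk}(\alpha)+\mathrm{rk}(\beta)$; if $1\le j\le k$, $\mathrm{rk}(\alpha)\ge j$ and $\mathrm{rk}(\alpha)+\mathrm{rk}(\beta)\le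 k+1$ then $(\alpha\odot_j\beta)$ is a term of rank $\mathrm{rk}(\alpha)+\mathrm{rk}(\beta)-1$. A term is ground if it contains no nonterminal; its value is the word of $\Sigma_1^*$ obtained by interpreting $\cdot$ as concatenation and $\odot_j$ as $j$-th intercalation. A context $C[x]$ is a term in which a variable $x$ of fixed rank occurs exactly once as a leaf; $C[\beta]$ denotes the substitution of a term $\beta$ of the same rank for $x$. A $k$-displacement context-free grammar ($k$-DCFG) is $G=\langle N,\Sigma,P,S\rangle$ with $S\in N$, $\mathrm{rk}(S)=0$, and $P$ a finite set of rules $A\to\alpha$ with $A\in N$, $\alpha\in Tm_k$, $\mathrm{rk}(A)=\mathrm{rk}(\alpha)$. Derivability $\vdash_G$ is the smallest reflexive transitive relation between nonterminals and terms such that $(B\to\beta)\in P$ and $A\vdash_G C[B]$ imply $A\vdash_G C[\beta]$ for every context $C$. $L(G)$ is the set of values of ground terms $\alpha$ with $S\vdash_G\alpha$. A $k$-DCFL is a language of the form $L(G)$ for a $k$-DCFG $G$ (over alphabet $\Sigma$). *)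

theory Defs
  imports Main
begin

datatype 'a sym = Sep | Sy 'a

text \<open>j-th intercalation (j counted from 1): replace the j-th occurrence of Sep in u by v.\<close>
fun intercal :: "nat \<Rightarrow> 'a sym list \<Rightarrow> 'a sym list \<Rightarrow> 'a sym list" where
  "intercal j [] v = []"
| "intercal j (Sep # u) v = (if j = 1 then v @ u else Sep # intercal (j - 1) u v)"
| "intercal j (Sy a # u) v = Sy a # intercal j u v"

definition rank_w :: "'a sym list \<Rightarrow> nat" where
  "rank_w w = length (filter (\<lambda>c. c = Sep) w)"

datatype ('n, 'a) tm =
    NT 'n
  | Wd "'a list"
  | One
  | Conc "('n, 'a) tm" "('n, 'a) tm"
  | Intc nat "('n, 'a) tm" "('n, 'a) tm"

fun trk :: "('n \<Rightarrow> nat) \<Rightarrow> ('n, 'a) tm \<Rightarrow> nat" where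
  "trk rk (NT A) = rk A"
| "trk rk (Wd w) = 0"
| "trk rk One = 1"
| "trk rk (Conc a b) = trk rk a + trk rk b"
| "trk rk (Intc j a b) = trk rk a + trk rk b - 1"

fun correct :: "nat \<Rightarrow> 'n set \<Rightarrow> ('n \<Rightarrow> nat) \<Rightarrow> ('n, 'a) tm \<Rightarrow> bool" where
  "correct k N rk (NT A) = (A \<in> N)"
| "correct k N rk (Wd w) = True"
| "correct k N rk One = True"
| "correct k N rk (Conc a b) =
     (correct k N rk a \<and> correct k N rk b \<and> trk rk a + trk rk b \<le> k)"
| "correct k N rk (Intc j a b) =
     (correct k N rk a \<and> correct k N rk b \<and> 1 \<le> j \<and> j \<le> k \<and> j \<le> trk rk a
      \<and> trk rk a + trk rk b \<le> k + 1)"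

fun ground :: "('n, 'a) tm \<Rightarrow> bool" where
  "ground (NT A) = False"
| "ground (Wd w) = True"
| "ground One = True"
| "ground (Conc a b) = (ground a \<and> ground b)"
| "ground (Intc j a b) = (ground a \<and> ground b)"

fun val :: "('n, 'a) tm \<Rightarrow> 'a sym list" where
  "val (NT A) = []"
| "val (Wd w) = map Sy w"
| "val One = [Sep]"
| "val (Conc a b) = val a @ val b"
| "val (Intc j a b) = intercal j (val a) (val b)"

record ('n, 'a) dcfg =
  Nts :: "'n set"
  rank :: "'n \<Rightarrow> nat"
  Rules :: "('n \<times> ('n, 'a) tm) set"
  Start :: 'n

definition is_dcfg :: "nat \<Rightarrow> ('n, 'a) dcfg \<Rightarrow> bool" where
  "is_dcfg k G \<longleftrightarrow>
     finite (Nts G) \<and> (\<forall>A\<in>Nts G. rank G A \<le> k) \<and>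
     Start G \<in> Nts G \<and> rank G (Start G) = 0 \<and> finite (Rules G) \<and>
     (\<forall>(A, \<alpha>)\<in>Rules G. A \<in> Nts G \<and> correct k (Nts G) (rank G) \<alpha> \<and>
                         rank G A = trk (rank G) \<alpha>)"

inductive step :: "('n \<times> ('n, 'a) tm) set \<Rightarrow> ('n, 'a) tm \<Rightarrow> ('n, 'a) tm \<Rightarrow> bool"
  for P where
  rule: "(B, \<beta>) \<in> P \<Longrightarrow> step P (NT B) \<beta>"
| concL: "step P a a' \<Longrightarrow> step P (Conc a b) (Conc a' b)"
| concR: "step P b b' \<Longrightarrow> step P (Conc a b) (Conc a b')"
| intcL: "step P a a' \<Longrightarrow> step P (Intc j a b) (Intc j a' b)"
| intcR: "step P b b' \<Longrightarrow> step P (Intc j a b) (Intc j a b')"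

definition derives :: "('n, 'a) dcfg \<Rightarrow> 'n \<Rightarrow> ('n, 'a) tm \<Rightarrow> bool" where
  "derives G A \<alpha> \<longleftrightarrow> (step (Rules G))\<^sup>*\<^sup>* (NT A) \<alpha>"

definition lang :: "('n, 'a) dcfg \<Rightarrow> 'a list set" where
  "lang G = {w. \<exists>\<alpha>. ground \<alpha> \<and> derives G (Start G) \<alpha> \<and> val \<alpha> = map Sy w}"

definition is_dcfl :: "nat \<Rightarrow> 'a list set \<Rightarrow> bool" where
  "is_dcfl k L \<longleftrightarrow> (\<exists>G :: (nat, 'a) dcfg. is_dcfg k G \<and> L = lang G)"

end

theory Submission
  imports Defs
begin

text \<open>Induction on the maximal rank \<open>K\<close> occurring in derivations. A connected region of rank
  \<open>K\<close> nodes in a derivation tree only contains even steps: each of them extends the \<open>K + 1\<close>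
  segments of its argument on both sides but never merges two of them. If a nonterminal is repeated
  on a path through such a region, we obtain an even pump with \<open>K + 1\<close> segments, and it is
  short if taken as low as possible. Otherwise the regions have bounded height. Now a region can
  only be left upwards by filling one of its gaps with a word \<open>b\<close> of rank \<open>0\<close>, and by
  associativity this \<open>b\<close> can be pushed down to the place where the gap was created. This
  rearranges the derivation into one of smaller rank, over the new nonterminals
  \<open>X \<odot>\<^sub>j B\<close>, and the induction hypothesis applies.

  Nonterminals are represented by the languages that they generate: the languages obtained from a
  finite family by boundedly many intercalations again form a finite family of the same type.\<close>

section \<open>Ranks and intercalation\<close>

lemma rank_w_simps [simp]:
  "rank_w [] = 0"
  "rank_w (Sep # w) = Suc (rank_w w)"
  "rank_w (Sy a # w) = rank_w w"
  "rank_w (u @ v) = rank_w u + rank_w v"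
  "rank_w (map Sy x) = 0"
  by (auto simp: rank_w_def filter_empty_conv)

lemma rank_w_0_iff: "rank_w w = 0 \<longleftrightarrow> (\<exists>x. w = map Sy x)"
proof
  show "rank_w w = 0 \<Longrightarrow> \<exists>x. w = map Sy x"
  proof (induction w)
    case (Cons c w)
    then show ?case
      by (cases c) (auto, metis list.simps(9))
  qed simp
qed auto

lemma intercal_outside: "\<not> (1 \<le> j \<and> j \<le> rank_w u) \<Longrightarrow> intercal j u v = u"
proof (induction j u v rule: intercal.induct)
  case (2 j u v)
  then have "\<not> (1 \<le> j - 1 \<and> j - 1 \<le> rank_w u)" "j \<noteq> 1" by auto
  then show ?case using 2 by simp
qed auto

text \<open>An index out of range changes nothing on either side, so the rule covers every
  \<open>j\<close>. Together with \<open>split_Sep\<close> it reduces the laws on nested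
  intercalations to list concatenation.\<close>

lemma intercal_append:
  "intercal j (u @ v) b =
    (if j \<le> rank_w u then intercal j u b @ v else u @ intercal (j - rank_w u) v b)"
proof (induction j u b rule: intercal.induct)
  case (2 j u b)
  then show ?case by (cases "j = 0") (auto simp: intercal_outside)
qed (auto simp: intercal_outside)

lemma intercal_map_Sy [simp]: "intercal j (map Sy x @ w) b = map Sy x @ intercal j w b"
  by (induction x) auto

lemma split_Sep:
  assumes "1 \<le> j" "j \<le> rank_w w"
  obtains w1 w2 where "w = w1 @ Sep # w2" "Suc (rank_w w1) = j"
proof -
  have "\<exists>w1 w2. w = w1 @ Sep # w2 \<and> Suc (rank_w w1) = j"
    using assms
  proof (induction w arbitrary: j)
    case (Cons c w)
    show ?case
    proof (cases c)
      case Sep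
      show ?thesis
      proof (cases "j = 1")
        case True
        then show ?thesis using Sep by (metis append_Nil rank_w_simps(1) One_nat_def)
      next
        case False
        then obtain w1 w2 where "w = w1 @ Sep # w2" "Suc (rank_w w1) = j - 1"
        proof -
          have "1 \<le> j - 1" "j - 1 \<le> rank_w w" using False Cons.prems Sep by auto
          then show thesis using Cons.IH that by blast
        qed
        then have "c # w = (Sep # w1) @ Sep # w2" "Suc (rank_w (Sep # w1)) = j"
          using Sep Cons.prems by auto
        then show ?thesis by blast
      qed
    next
      case (Sy a)
      then obtain w1 w2 where "w = w1 @ Sep # w2" "Suc (rank_w w1) = j"
        using Cons.IH[of j] Cons.prems by auto
      then have "c # w = (Sy a # w1) @ Sep # w2" "Suc (rank_w (Sy a # w1)) = j"
        using Sy by auto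
      then show ?thesis by blast
    qed
  qed simp
  then show thesis using that by blast
qed

lemma intercal_split: "Suc (rank_w u1) = j \<Longrightarrow> intercal j (u1 @ Sep # u2) v = u1 @ v @ u2"
  by (auto simp: intercal_append)

lemma rank_w_intercal:
  "1 \<le> j \<Longrightarrow> j \<le> rank_w u \<Longrightarrow> Suc (rank_w (intercal j u v)) = rank_w u + rank_w v"
  by (erule (1) split_Sep) (simp add: intercal_split)

lemma length_intercal:
  "1 \<le> j \<Longrightarrow> j \<le> rank_w u \<Longrightarrow> Suc (length (intercal j u v)) = length u + length v"
  by (erule (1) split_Sep) (simp add: intercal_split)

lemma intercal_Sep [simp]: "intercal j u [Sep] = u"
  by (induction j u "[Sep] :: 'a sym list" rule: intercal.induct) auto

section \<open>Associativity of nested intercalations\<close>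

text \<open>Three laws locate the gap \<open>j\<close> after \<open>v\<close> has filled the gap
  \<open>i\<close> of \<open>u\<close>: in \<open>u\<close> before \<open>v\<close>, inside
  \<open>v\<close>, or in \<open>u\<close> after \<open>v\<close>. Here \<open>b\<close> of rank
  \<open>0\<close> uses up the gap \<open>j\<close>, which renumbers the gap \<open>i\<close> as
  \<open>i - 1\<close>.\<close>

lemma intercal_intercal_left:
  assumes "1 \<le> j" "j < i" "i \<le> rank_w u" "rank_w b = 0"
  shows "intercal j (intercal i u v) b = intercal (i - 1) (intercal j u b) v"
proof -
  have "1 \<le> i" "i \<le> rank_w u" using assms by auto
  then obtain u1 u2 where u: "u = u1 @ Sep # u2" "Suc (rank_w u1) = i" by (rule split_Sep)
  have "Suc (rank_w (intercal j u1 b)) = rank_w u1"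
    using rank_w_intercal[of j u1 b] assms u by auto
  then show ?thesis
    using u assms by (auto simp: intercal_split intercal_append)
qed

lemma intercal_intercal_inside:
  assumes "1 \<le> i" "i \<le> rank_w u" "i \<le> j" "j < i + rank_w v"
  shows "intercal j (intercal i u v) b = intercal i u (intercal (Suc j - i) v b)"
proof -
  have "1 \<le> i" "i \<le> rank_w u" using assms by auto
  then obtain u1 u2 where u: "u = u1 @ Sep # u2" "Suc (rank_w u1) = i" by (rule split_Sep)
  then have "j - rank_w u1 = Suc j - i" by simp
  then show ?thesis
    using u assms by (auto simp: intercal_split intercal_append)
qed

text \<open>Gap \<open>j\<close> of the result is gap \<open>j + 1 - rank_w v\<close> of
  \<open>u\<close>. It lies after gap \<open>i\<close>, so filling it first does not renumber gap
  \<open>i\<close>.\<close>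

lemma intercal_intercal_right:
  assumes "1 \<le> i" "i \<le> rank_w u" "i + rank_w v \<le> j"
  shows "intercal j (intercal i u v) b = intercal i (intercal (Suc j - rank_w v) u b) v"
proof -
  have "1 \<le> i" "i \<le> rank_w u" using assms by auto
  then obtain u1 u2 where u: "u = u1 @ Sep # u2" "Suc (rank_w u1) = i" by (rule split_Sep)
  have "Suc j - rank_w v - rank_w u1 = Suc (j - rank_w u1 - rank_w v)"
       "j - rank_w u1 - rank_w v \<noteq> 0"
    using u assms by auto
  then show ?thesis
    using u assms by (auto simp: intercal_split intercal_append)
qed


section \<open>Pumpable words\<close>

abbreviation (input) pow :: "nat \<Rightarrow> 'a list \<Rightarrow> 'a list" where
  "pow p x \<equiv> concat (replicate p x)"

text \<open>The separating blocks \<open>t\<close> and \<open>s\<close> may contain separators, the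
  pumped parts do not. Hence the number of gaps is the same for all \<open>p\<close>.\<close>

definition pword ::
  "nat \<Rightarrow> 'a sym list \<Rightarrow> ('a list \<times> 'a list \<times> 'a list \<times> 'a sym list) list \<Rightarrow> 'a sym list" where
  "pword p t ps = t @ concat (map (\<lambda>(y, u, z, s). map Sy (pow p y @ u @ pow p z) @ s) ps)"

abbreviation triples ::
  "('a list \<times> 'a list \<times> 'a list \<times> 'a sym list) list \<Rightarrow> ('a list \<times> 'a list \<times> 'a list) list" where
  "triples \<equiv> map (\<lambda>(y, u, z, s). (y, u, z))"

text \<open>Stated for words of any rank, so that it can be passed up through a derivation whose
  intermediate words have gaps.\<close>

definition pumpable :: "nat \<Rightarrow> nat \<Rightarrow> 'a sym list set \<Rightarrow> 'a sym list \<Rightarrow> bool" where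
  "pumpable l n X w \<longleftrightarrow> (\<exists>t ps. length ps \<le> l \<and> w = pword 1 t ps \<and>
     0 < length (concat (map (\<lambda>(y, u, z). y @ z) (triples ps))) \<and>
     length (concat (map (\<lambda>(y, u, z). y @ u @ z) (triples ps))) \<le> n \<and>
     (\<forall>p. pword p t ps \<in> X))"

lemma pword_Nil [simp]: "pword p t [] = t"
  by (simp add: pword_def)

lemma pword_Cons [simp]:
  "pword p t ((y, u, z, s) # ps) = t @ map Sy (pow p y @ u @ pow p z) @ pword p s ps"
  by (simp add: pword_def)

lemma pumpable_mono: "pumpable l n X w \<Longrightarrow> l \<le> l' \<Longrightarrow> n \<le> n' \<Longrightarrow> pumpable l' n' X w"
  unfolding pumpable_def by (elim exE conjE, intro exI conjI) (assumption | erule (1) order_trans)+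

text \<open>Every context obtained by filling gaps and concatenating acts on the words
  \<open>pword p t ps\<close> through the separating blocks only, uniformly in \<open>p\<close>.\<close>

lemma pumpable_lift:
  assumes "pumpable l n Y w"
    and g: "\<And>t ps. \<exists>t' ps'. triples ps' = triples ps \<and> (\<forall>p. g (pword p t ps) = pword p t' ps')"
    and "\<And>y. y \<in> Y \<Longrightarrow> g y \<in> X"
  shows "pumpable l n X (g w)"
proof -
  obtain t ps where 1: "length ps \<le> l" "w = pword 1 t ps"
     "0 < length (concat (map (\<lambda>(y, u, z). y @ z) (triples ps)))"
     "length (concat (map (\<lambda>(y, u, z). y @ u @ z) (triples ps))) \<le> n"
     "\<forall>p. pword p t ps \<in> Y"
    using assms(1) unfolding pumpable_def by blast
  obtain t' ps' where 2: "triples ps' = triples ps" "\<And>p. g (pword p t ps) = pword p t' ps'"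
    using g[of ps t] by blast
  have "length ps' = length ps" using 2(1) by (metis length_map)
  then show ?thesis
    unfolding pumpable_def using 1 2 assms(3) by metis
qed

lemma pword_append:
  "\<exists>t' ps'. triples ps' = triples ps \<and> (\<forall>p. a @ pword p t ps @ b = pword p t' ps')"
proof -
  have "\<exists>t' ps'. triples ps' = triples ps \<and> (\<forall>p. pword p t ps @ b = pword p t' ps')"
  proof (induction ps arbitrary: t)
    case Nil
    then show ?case by auto
  next
    case (Cons q ps)
    obtain y u z s where q: "q = (y, u, z, s)" by (cases q)
    obtain t' ps' where "triples ps' = triples ps" "\<forall>p. pword p s ps @ b = pword p t' ps'"
      using Cons by blast
    then have "triples ((y, u, z, t') # ps') = triples (q # ps)"
       "\<forall>p. pword p t (q # ps) @ b = pword p t ((y, u, z, t') # ps')"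
      using q by auto
    then show ?case by blast
  qed
  then obtain t' ps' where "triples ps' = triples ps" "\<forall>p. pword p t ps @ b = pword p t' ps'"
    by blast
  then have "triples ps' = triples ps" "\<forall>p. a @ pword p t ps @ b = pword p (a @ t') ps'"
    by (auto simp: pword_def)
  then show ?thesis by blast
qed

text \<open>Pumped parts contain no separators, so the block in which the \<open>j\<close>-th gap
  lies does not depend on \<open>p\<close>, and only this block changes.\<close>

lemma pword_intercal:
  "\<exists>t' ps'. triples ps' = triples ps \<and> (\<forall>p. intercal j (pword p t ps) b = pword p t' ps')"
proof (induction ps arbitrary: t j)
  case Nil
  then show ?case by auto
next
  case (Cons q ps)
  obtain y u z s where q: "q = (y, u, z, s)" by (cases q)
  show ?case
  proof (cases "j \<le> rank_w t")
    case True
    then have "\<forall>p. intercal j (pword p t (q # ps)) b = pword p (intercal j t b) (q # ps)"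
      using q by (simp add: intercal_append)
    then show ?thesis by blast
  next
    case False
    obtain t' ps' where 1: "triples ps' = triples ps"
      "\<forall>p. intercal (j - rank_w t) (pword p s ps) b = pword p t' ps'"
      using Cons by blast
    have "\<forall>p. intercal j (pword p t (q # ps)) b = pword p t ((y, u, z, t') # ps')"
    proof
      fix p
      have "intercal j (pword p t (q # ps)) b =
        t @ intercal (j - rank_w t) (map Sy (pow p y @ u @ pow p z) @ pword p s ps) b"
        using q False by (simp add: intercal_append[of _ t])
      then show "intercal j (pword p t (q # ps)) b = pword p t ((y, u, z, t') # ps')"
        using 1 by (simp only: intercal_map_Sy pword_Cons)
    qed
    moreover have "triples ((y, u, z, t') # ps') = triples (q # ps)" using q 1 by auto
    ultimately show ?thesis by blast
  qed
qed

lemma pumpable_append: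
  "pumpable l n Y w \<Longrightarrow> (\<And>y. y \<in> Y \<Longrightarrow> a @ y @ b \<in> X) \<Longrightarrow> pumpable l n X (a @ w @ b)"
  by (rule pumpable_lift[where g = "\<lambda>w. a @ w @ b"]) (auto intro: pword_append)

lemma pumpable_conc_left:
  "pumpable l n Y u \<Longrightarrow> (\<And>y. y \<in> Y \<Longrightarrow> y @ v \<in> X) \<Longrightarrow> pumpable l n X (u @ v)"
  using pumpable_append[of l n Y u "[]" v X] by simp

lemma pumpable_conc_right:
  "pumpable l n Z v \<Longrightarrow> (\<And>z. z \<in> Z \<Longrightarrow> u @ z \<in> X) \<Longrightarrow> pumpable l n X (u @ v)"
  using pumpable_append[of l n Z v u "[]" X] by simp

lemma pumpable_intercal_left:
  "pumpable l n Y u \<Longrightarrow> (\<And>y. y \<in> Y \<Longrightarrow> intercal j y v \<in> X) \<Longrightarrow> pumpable l n X (intercal j u v)"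
  by (rule pumpable_lift[where g = "\<lambda>w. intercal j w v"]) (auto intro: pword_intercal)

text \<open>Filling an existing gap surrounds \<open>v\<close> by two fixed words; with an index out
  of range \<open>v\<close> would be lost.\<close>

lemma pumpable_intercal_right:
  assumes "pumpable l n Z v" "\<And>z. z \<in> Z \<Longrightarrow> intercal j u z \<in> X" "1 \<le> j" "j \<le> rank_w u"
  shows "pumpable l n X (intercal j u v)"
proof -
  obtain u1 u2 where "u = u1 @ Sep # u2" "Suc (rank_w u1) = j"
    using assms(3,4) by (rule split_Sep)
  then have "\<And>v. intercal j u v = u1 @ v @ u2" by (simp add: intercal_split)
  then show ?thesis using pumpable_append assms(1,2) by metis
qed


section \<open>Even contexts\<close>

text \<open>Normal form of a word of rank \<open>K\<close>: its \<open>K + 1\<close> segments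
  between separators. The value on the empty list is a mere default.\<close>

primrec join :: "'a list list \<Rightarrow> 'a sym list" where
  "join [] = []"
| "join (x # xs) = map Sy x @ concat (map (\<lambda>y. Sep # map Sy y) xs)"

lemma rank_w_join_tail: "rank_w (concat (map (\<lambda>y. Sep # map Sy y) xs)) = length xs"
  by (induction xs) auto

lemma rank_w_join: "length us = Suc K \<Longrightarrow> rank_w (join us) = K"
  by (cases us) (auto simp: rank_w_join_tail)

lemma obtain_join:
  assumes "rank_w w = K"
  obtains us where "w = join us" "length us = Suc K"
proof -
  have "\<exists>us. w = join us \<and> length us = Suc K"
    using assms
  proof (induction w arbitrary: K)
    case Nil
    then show ?case by (intro exI[of _ "[[]]"]) auto
  next
    case (Cons c w)
    obtain us where us: "w = join us" "length us = Suc (rank_w w)" using Cons.IH by blast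
    then obtain x xs where xs: "us = x # xs" by (cases us) auto
    show ?case
    proof (cases c)
      case Sep
      then show ?thesis using us xs Cons.prems by (intro exI[of _ "[] # us"]) auto
    next
      case (Sy a)
      then show ?thesis using us xs Cons.prems by (intro exI[of _ "(a # x) # xs"]) auto
    qed
  qed
  then show thesis using that by blast
qed

definition wrap :: "('a list \<times> 'a list) list \<Rightarrow> 'a list list \<Rightarrow> 'a list list" where
  "wrap cs us = map2 (\<lambda>(y, z) u. y @ u @ z) cs us"

text \<open>An even context keeps the \<open>K + 1\<close> segments of its argument apart, so that it can be iterated
  segmentwise.\<close>

definition even_ctx :: "nat \<Rightarrow> ('a sym list \<Rightarrow> 'a sym list) \<Rightarrow> bool" where
  "even_ctx K f \<longleftrightarrow> (\<exists>cs. length cs = Suc K \<and>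
     (\<forall>us. length us = Suc K \<longrightarrow> f (join us) = join (wrap cs us)))"

lemma wrap_Cons [simp]: "wrap ((y, z) # cs) (u # us) = (y @ u @ z) # wrap cs us"
  by (simp add: wrap_def)

lemma wrap_Nil [simp]: "wrap [] us = []" "wrap cs [] = []"
  by (auto simp: wrap_def)

lemma length_wrap [simp]: "length cs = length us \<Longrightarrow> length (wrap cs us) = length us"
  by (simp add: wrap_def)

lemma wrap_empty: "length us = n \<Longrightarrow> wrap (replicate n ([], [])) us = us"
  by (induction us arbitrary: n) auto

lemma wrap_wrap:
  "length cs = length ds \<Longrightarrow> length ds = length us \<Longrightarrow>
   wrap cs (wrap ds us) = wrap (map2 (\<lambda>(y, z) (y', z'). (y @ y', z' @ z)) cs ds) us"
  by (induction cs ds us rule: list_induct3) auto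

lemma length_join_wrap:
  "length cs = length us \<Longrightarrow> length (join us) \<le> length (join (wrap cs us))"
proof -
  have "length (concat (map (\<lambda>y. Sep # map Sy y) us))
      \<le> length (concat (map (\<lambda>y. Sep # map Sy y) (wrap cs us)))"
    if "length cs = length us" for cs :: "('a list \<times> 'a list) list" and us
    using that by (induction cs us rule: list_induct2) auto
  note tl = this
  assume "length cs = length us"
  then show ?thesis
    by (cases cs; cases us) (auto intro!: add_mono tl trans_le_add2)
qed

lemma even_ctx_rank: "even_ctx K f \<Longrightarrow> rank_w u = K \<Longrightarrow> rank_w (f u) = K"
  by (erule obtain_join) (auto simp: even_ctx_def rank_w_join)

lemma even_ctx_length: "even_ctx K f \<Longrightarrow> rank_w u = K \<Longrightarrow> length u \<le> length (f u)"
  by (erule obtain_join) (auto simp: even_ctx_def length_join_wrap)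

lemma even_ctx_id: "even_ctx K (\<lambda>w. w)"
  unfolding even_ctx_def by (intro exI[of _ "replicate (Suc K) ([], [])"]) (metis length_replicate wrap_empty)

lemma even_ctx_comp:
  assumes "even_ctx K f" "even_ctx K g"
  shows "even_ctx K (\<lambda>w. f (g w))"
proof -
  obtain cs ds where cs: "length cs = Suc K" "\<And>us. length us = Suc K \<Longrightarrow> f (join us) = join (wrap cs us)"
    and ds: "length ds = Suc K" "\<And>us. length us = Suc K \<Longrightarrow> g (join us) = join (wrap ds us)"
    using assms unfolding even_ctx_def by blast
  show ?thesis unfolding even_ctx_def
    by (rule exI[of _ "map2 (\<lambda>(y, z) (y', z'). (y @ y', z' @ z)) cs ds"])
      (simp add: cs ds wrap_wrap)
qed

lemma even_ctx_prepend: "even_ctx K (\<lambda>w. map Sy x @ w)"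
  unfolding even_ctx_def
proof (intro exI[of _ "(x, []) # replicate K ([], [])"] conjI allI impI)
  fix us :: "'a list list"
  assume "length us = Suc K"
  then show "map Sy x @ join us = join (wrap ((x, []) # replicate K ([], [])) us)"
    by (cases us) (auto simp: wrap_empty)
qed simp

lemma join_Cons: "us \<noteq> [] \<Longrightarrow> join (x # us) = map Sy x @ Sep # join us"
  by (cases us) auto

text \<open>Raises the rank by splitting off the first segment: the context appends \<open>x\<close>
  to it and acts on the remaining segments by the even context \<open>f\<close>.\<close>

lemma even_ctx_Suc:
  assumes "even_ctx K f"
    and "\<And>u w. rank_w w = K \<Longrightarrow> g (map Sy u @ Sep # w) = map Sy (u @ x) @ Sep # f w"
  shows "even_ctx (Suc K) g"
proof -
  obtain cs where cs: "length cs = Suc K" "\<And>us. length us = Suc K \<Longrightarrow> f (join us) = join (wrap cs us)"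
    using assms unfolding even_ctx_def by blast
  show ?thesis unfolding even_ctx_def
  proof (intro exI[of _ "([], x) # cs"] conjI allI impI)
    fix us :: "'a list list"
    assume "length us = Suc (Suc K)"
    then obtain u vs where us: "us = u # vs" "length vs = Suc K" by (cases us) auto
    have "g (join us) = map Sy (u @ x) @ Sep # f (join vs)"
      using us assms(2)[of "join vs" u] by (subst us(1), subst join_Cons) (auto simp: rank_w_join)
    also have "\<dots> = join (wrap (([], x) # cs) us)"
    proof -
      have "wrap cs vs \<noteq> []" using cs us by (metis length_wrap length_0_conv nat.simps(3))
      then show ?thesis using us cs by (simp add: join_Cons del: join.simps)
    qed
    finally show "g (join us) = join (wrap (([], x) # cs) us)" .
  qed (simp add: cs)
qed

lemma even_ctx_append: "even_ctx K (\<lambda>w. w @ map Sy x)"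
proof (induction K)
  case 0
  show ?case unfolding even_ctx_def
  proof (intro exI[of _ "[([], x)]"] conjI allI impI)
    fix us :: "'a list list"
    assume "length us = Suc 0"
    then show "join us @ map Sy x = join (wrap [([], x)] us)"
      by (cases us) auto
  qed simp
next
  case (Suc K)
  then show ?case by (rule even_ctx_Suc[where x = "[]"]) auto
qed

text \<open>If \<open>v\<close> consists of \<open>a\<close>, a separator and \<open>b\<close>, then
  \<open>a\<close> is appended to the segment before the gap and \<open>b\<close> is prepended to
  the one after it. The separator of \<open>v\<close> replaces the filled one, so no segments
  merge.\<close>

lemma even_ctx_intercal:
  assumes "rank_w v = 1" "1 \<le> j" "j \<le> K"
  shows "even_ctx K (\<lambda>w. intercal j w v)"
proof -
  have "1 \<le> rank_w v" using assms by simp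
  then obtain v1 v2 where "v = v1 @ Sep # v2" "Suc (rank_w v1) = 1"
    by (rule split_Sep[OF order_refl])
  moreover from this have "rank_w v1 = 0" "rank_w v2 = 0" using assms by simp_all
  ultimately obtain a b where v: "v = map Sy a @ Sep # map Sy b"
    by (metis rank_w_0_iff)
  show ?thesis using assms(2,3)
  proof (induction K arbitrary: j)
    case (Suc K)
    show ?case
    proof (cases "j = 1")
      case True
      then show ?thesis
        by (intro even_ctx_Suc[OF even_ctx_prepend[of K b], where x = a]) (simp add: v)
    next
      case False
      then have "even_ctx K (\<lambda>w. intercal (j - 1) w v)" using Suc by auto
      then show ?thesis
        by (rule even_ctx_Suc[where x = "[]"]) (use False in simp)
    qed
  qed simp
qed

lemma even_ctx_intercal_into:
  assumes "rank_w u = 1"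
  shows "even_ctx K (\<lambda>w. intercal 1 u w)"
proof -
  have "1 \<le> rank_w u" using assms by simp
  then obtain u1 u2 where u: "u = u1 @ Sep # u2" "Suc (rank_w u1) = 1"
    by (rule split_Sep[OF order_refl])
  then have "rank_w u1 = 0" "rank_w u2 = 0" using assms by simp_all
  then obtain a b where "u1 = map Sy a" "u2 = map Sy b"
    using u by (metis rank_w_0_iff)
  then have "(\<lambda>w. intercal 1 u w) = (\<lambda>w. map Sy a @ (w @ map Sy b))"
    using u by (simp add: fun_eq_iff)
  then show ?thesis
    using even_ctx_comp[OF even_ctx_prepend[of K a] even_ctx_append[of K b]] by simp
qed

section \<open>Iterating even contexts\<close>

lemma pow_Suc_right: "pow p x @ x = x @ pow p x"
  by (induction p) auto

lemma wrap_power: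
  assumes "length cs = length us"
  shows "(wrap cs ^^ p) us = wrap (map (\<lambda>(y, z). (pow p y, pow p z)) cs) us"
proof (induction p)
  case 0
  then show ?case using assms
    by (induction cs us rule: list_induct2) auto
next
  case (Suc p)
  have "wrap cs (wrap (map (\<lambda>(y, z). (pow p y, pow p z)) cs) us) =
    wrap (map (\<lambda>(y, z). (pow (Suc p) y, pow (Suc p) z)) cs) us"
    using assms by (induction cs us rule: list_induct2) (auto simp: pow_Suc_right)
  then show ?case using Suc by simp
qed

text \<open>The segments become the middle words, and the separators between them become the blocks
  \<open>s\<close>; one list \<open>ps\<close> serves all \<open>p\<close>.\<close>

lemma join_wrap_power_pword:
  assumes "length cs = length us" "us \<noteq> []"
  shows "\<exists>ps. length ps = length us \<and>
    (\<forall>p. join (wrap (map (\<lambda>(y, z). (pow p y, pow p z)) cs) us) = pword p [] ps)"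
  using assms
proof (induction cs us rule: list_induct2)
  case (Cons c cs u us)
  obtain y z where c: "c = (y, z)" by (cases c)
  show ?case
  proof (cases "us = []")
    case True
    then show ?thesis using Cons c by (intro exI[of _ "[(y, u, z, [])]"]) auto
  next
    case False
    then obtain ps where ps: "length ps = length us"
      "\<And>p. join (wrap (map (\<lambda>(y, z). (pow p y, pow p z)) cs) us) = pword p [] ps"
      using Cons by blast
    have "wrap (map (\<lambda>(y, z). (pow p y, pow p z)) cs) us \<noteq> []" for p
      using Cons.hyps False by (metis length_0_conv length_map length_wrap)
    moreover have "pword p [Sep] ps = Sep # pword p [] ps" for p
      by (simp add: pword_def)
    ultimately show ?thesis using ps c
      by (intro exI[of _ "(y, u, z, [Sep]) # ps"]) (auto simp: join_Cons simp del: join.simps)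
  qed
qed simp

text \<open>Setting \<open>p\<close> to \<open>0\<close> deletes exactly the words \<open>y\<close>
  and \<open>z\<close>, so a strict increase in length from \<open>p = 0\<close> to
  \<open>p = 1\<close> shows that they are not all empty.\<close>

lemma length_pword:
  "length (pword 1 t ps) =
    length (pword 0 t ps) + length (concat (map (\<lambda>(y, u, z). y @ z) (triples ps)))"
  "length (concat (map (\<lambda>(y, u, z). y @ u @ z) (triples ps))) \<le> length (pword 1 t ps)"
proof -
  show "length (pword 1 t ps) =
    length (pword 0 t ps) + length (concat (map (\<lambda>(y, u, z). y @ z) (triples ps)))"
    by (induction ps arbitrary: t) (auto simp: pword_def)
  show "length (concat (map (\<lambda>(y, u, z). y @ u @ z) (triples ps))) \<le> length (pword 1 t ps)"
  proof (induction ps arbitrary: t)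
    case (Cons q ps)
    obtain y u z s where "q = (y, u, z, s)" by (cases q)
    then show ?case using Cons[of s] by simp
  qed simp
qed

text \<open>Iterating \<open>f\<close> on \<open>u\<close> stays within \<open>X\<close> and raises
  each \<open>y\<close> and \<open>z\<close> to the \<open>p\<close>-th power segmentwise;
  \<open>u\<close> and \<open>f u\<close> are the cases \<open>p = 0\<close> and
  \<open>p = 1\<close>.\<close>

lemma pumpable_even_ctx:
  assumes "even_ctx K f" "rank_w u = K" "length u < length (f u)"
    and "u \<in> X" "\<And>x. x \<in> X \<Longrightarrow> rank_w x = K \<Longrightarrow> f x \<in> X"
  shows "pumpable (Suc K) (length (f u)) X (f u)"
proof -
  obtain cs where cs: "length cs = Suc K" "\<And>us. length us = Suc K \<Longrightarrow> f (join us) = join (wrap cs us)"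
    using assms(1) unfolding even_ctx_def by blast
  obtain us where us: "u = join us" "length us = Suc K" using assms(2) by (rule obtain_join)
  obtain ps where ps: "length ps = Suc K"
    "\<And>p. join (wrap (map (\<lambda>(y, z). (pow p y, pow p z)) cs) us) = pword p [] ps"
  proof -
    have "length cs = length us" "us \<noteq> []" using cs us by auto
    then show thesis using join_wrap_power_pword[of cs us] us(2) that by auto
  qed
  have "length ((wrap cs ^^ p) us) = Suc K \<and> (f ^^ p) u = join ((wrap cs ^^ p) us) \<and> (f ^^ p) u \<in> X" for p
  proof (induction p)
    case (Suc p)
    then show ?case using cs assms(5)[of "(f ^^ p) u"] by (auto simp: rank_w_join)
  qed (use us assms in auto)
  then have "(f ^^ p) u = pword p [] ps \<and> pword p [] ps \<in> X" for p
    using ps wrap_power[of cs us p] cs us by metis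
  moreover from this[of 0] this[of 1] have "u = pword 0 [] ps" "f u = pword 1 [] ps" by auto
  ultimately show ?thesis
    unfolding pumpable_def using ps(1) length_pword(1)[of "[]" ps] length_pword(2)[of ps "[]"] assms(3)
    by (intro exI[of _ "[]"] exI[of _ ps]) auto
qed


section \<open>Derivations inside a family of languages\<close>

definition intc_set :: "nat \<Rightarrow> 'a sym list set \<Rightarrow> 'a sym list set \<Rightarrow> 'a sym list set" where
  "intc_set j X Y = {intercal j x y | x y. x \<in> X \<and> y \<in> Y}"

text \<open>Replaces the rank function of a grammar: the rank of a language is the common rank of
  its words.\<close>

definition homog :: "'a sym list set set \<Rightarrow> bool" where
  "homog F \<longleftrightarrow> (\<forall>X\<in>F. \<forall>u\<in>X. \<forall>v\<in>X. rank_w u = rank_w v)"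

text \<open>The languages in \<open>F\<close> serve as nonterminals, and every inclusion
  between them that has the shape of a production may be used as one. Hence unit
  productions are superfluous, and steps that do not change the word can be excluded without loss
  of generality. All ranks are \<^emph>\<open>smaller\<close> than \<open>K\<close>.\<close>

inductive der :: "'a sym list set set \<Rightarrow> nat \<Rightarrow> nat \<Rightarrow> 'a sym list set \<Rightarrow> 'a sym list \<Rightarrow> bool"
  for F c K where
  leaf: "X \<in> F \<Longrightarrow> w \<in> X \<Longrightarrow> length w \<le> c \<Longrightarrow> rank_w w = 0 \<or> w = [Sep] \<Longrightarrow> rank_w w < K
    \<Longrightarrow> der F c K X w"
| conc: "X \<in> F \<Longrightarrow> der F c K Y u \<Longrightarrow> der F c K Z v \<Longrightarrow> \<forall>y\<in>Y. \<forall>z\<in>Z. y @ z \<in> X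
    \<Longrightarrow> u \<noteq> [] \<Longrightarrow> v \<noteq> [] \<Longrightarrow> rank_w u + rank_w v < K \<Longrightarrow> der F c K X (u @ v)"
| intc: "X \<in> F \<Longrightarrow> der F c K Y u \<Longrightarrow> der F c K Z v \<Longrightarrow> \<forall>y\<in>Y. \<forall>z\<in>Z. intercal j y z \<in> X
    \<Longrightarrow> u \<noteq> [Sep] \<Longrightarrow> v \<noteq> [Sep] \<Longrightarrow> 1 \<le> j \<Longrightarrow> j \<le> rank_w u \<Longrightarrow> rank_w u + rank_w v \<le> K
    \<Longrightarrow> der F c K X (intercal j u v)"

lemma der_sound: "der F c K X w \<Longrightarrow> X \<in> F \<and> w \<in> X \<and> rank_w w < K"
proof (induction rule: der.induct)
  case (intc X Y u Z v j)
  then show ?case using rank_w_intercal[of j u v] by auto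
qed auto

text \<open>A rule only asks for an inclusion into its left-hand side, so the root may be relabelled
  by any larger language of the family. This absorbs unit productions.\<close>

lemma der_mono:
  assumes "der F c K Y w" "Y \<subseteq> X" "X \<in> F"
  shows "der F c K X w"
  using assms(1)
proof cases
  case leaf
  then show ?thesis using assms by (auto intro: der.leaf)
next
  case (conc Y' u Z v)
  then show ?thesis using assms by (auto intro!: der.conc[of X F c K Y' u Z v])
next
  case (intc Y' u Z v j)
  then show ?thesis using assms by (auto intro!: der.intc[of X F c K Y' u Z v j])
qed

text \<open>Removes the exclusion of empty factors: if the empty word \<open>u\<close> lies in
  \<open>Y\<close>, then \<open>Z\<close> is included in \<open>X\<close>, and the derivation of
  \<open>v\<close> is relabelled.\<close>

lemma der_conc:
  assumes "X \<in> F" "der F c K Y u" "der F c K Z v" "\<And>y z. y \<in> Y \<Longrightarrow> z \<in> Z \<Longrightarrow> y @ z \<in> X"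
    and "rank_w u + rank_w v < K"
  shows "der F c K X (u @ v)"
proof -
  have "u \<in> Y" "v \<in> Z" using assms der_sound by blast+
  consider "u = []" | "v = []" | "u \<noteq> []" "v \<noteq> []" by blast
  then show ?thesis
  proof cases
    case 1
    then have "Z \<subseteq> X" using assms(4) \<open>u \<in> Y\<close> by force
    then show ?thesis using der_mono assms 1 by auto
  next
    case 2
    then have "Y \<subseteq> X" using assms(4) \<open>v \<in> Z\<close> by force
    then show ?thesis using der_mono assms 2 by auto
  qed (use assms der.conc in blast)
qed

text \<open>The same reduction with \<open>[Sep]\<close>, neutral for intercalation, in place of the
  empty word.\<close>

lemma der_intc:
  assumes "X \<in> F" "der F c K Y u" "der F c K Z v" "\<And>y z. y \<in> Y \<Longrightarrow> z \<in> Z \<Longrightarrow> intercal j y z \<in> X"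
    and "1 \<le> j" "j \<le> rank_w u" "rank_w u + rank_w v \<le> K"
  shows "der F c K X (intercal j u v)"
proof -
  have *: "u \<in> Y" "v \<in> Z" using assms der_sound by blast+
  consider "u = [Sep]" | "v = [Sep]" | "u \<noteq> [Sep]" "v \<noteq> [Sep]" by blast
  then show ?thesis
  proof cases
    case 1
    then have "j = 1" using assms by simp
    then have "Z \<subseteq> X" using assms(4)[of "[Sep]"] * 1 by auto
    then show ?thesis using der_mono assms 1 \<open>j = 1\<close> by auto
  next
    case 2
    then have "Y \<subseteq> X" using assms(4)[of _ "[Sep]"] * by auto
    then show ?thesis using der_mono assms 2 by auto
  qed (use assms der.intc in blast)
qed

section \<open>Closing a family under gap filling\<close>

text \<open>Stage \<open>i\<close> holds the right-nested products of at most \<open>i\<close>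
  members of \<open>F\<close> with an innermost member of \<open>F\<close>. This shape suffices
  because a filler is only ever wrapped by labels taken from \<open>F\<close>.\<close>

primrec fill_closure :: "'a sym list set set \<Rightarrow> nat \<Rightarrow> nat \<Rightarrow> 'a sym list set set" where
  "fill_closure F K 0 = F"
| "fill_closure F K (Suc i) =
     fill_closure F K i \<union> (\<Union>j\<le>K. \<Union>X\<in>F. intc_set j X ` fill_closure F K i)"

lemma finite_fill_closure: "finite F \<Longrightarrow> finite (fill_closure F K i)"
  by (induction i) auto

lemma fill_closure_mono: "i \<le> i' \<Longrightarrow> fill_closure F K i \<subseteq> fill_closure F K i'"
  by (rule lift_Suc_mono_le[of "fill_closure F K"]) auto

lemma intc_set_fill_closure:
  "X \<in> F \<Longrightarrow> B \<in> fill_closure F K i \<Longrightarrow> j \<le> K \<Longrightarrow> intc_set j X B \<in> fill_closure F K (Suc i)"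
  by auto

lemma rank_w_intercal_cong:
  assumes "rank_w u = rank_w u'" "rank_w v = rank_w v'"
  shows "rank_w (intercal j u v) = rank_w (intercal j u' v')"
proof (cases "1 \<le> j \<and> j \<le> rank_w u")
  case True
  then have "Suc (rank_w (intercal j u v)) = Suc (rank_w (intercal j u' v'))"
    using assms by (simp add: rank_w_intercal)
  then show ?thesis by simp
next
  case False
  then show ?thesis using assms by (simp add: intercal_outside)
qed

lemma homog_fill_closure:
  assumes "homog F"
  shows "homog (fill_closure F K i)"
proof (induction i)
  case (Suc i)
  have *: "rank_w u = rank_w v"
    if a: "X \<in> F" "B \<in> fill_closure F K i" "u \<in> intc_set j X B" "v \<in> intc_set j X B" for X B j u v
  proof -
    obtain x b x' b' where *: "u = intercal j x b" "v = intercal j x' b'" "x \<in> X" "x' \<in> X" "b \<in> B" "b' \<in> B"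
      using a(3,4) unfolding intc_set_def by blast
    then have "rank_w x = rank_w x'" "rank_w b = rank_w b'"
      using assms Suc a(1,2) unfolding homog_def by blast+
    then show ?thesis using * rank_w_intercal_cong by blast
  qed
  show ?case unfolding homog_def
  proof (intro ballI)
    fix Y u v assume Y: "Y \<in> fill_closure F K (Suc i)" and uv: "u \<in> Y" "v \<in> Y"
    from Y consider "Y \<in> fill_closure F K i"
      | j X B where "X \<in> F" "B \<in> fill_closure F K i" "Y = intc_set j X B"
      by auto
    then show "rank_w u = rank_w v"
    proof cases
      case 1
      then show ?thesis using Suc uv unfolding homog_def by blast
    next
      case 2
      then show ?thesis using * uv by blast
    qed
  qed
qed (simp add: assms)


section \<open>Eliminating the top rank\<close>

text \<open>Here \<open>Y\<close> labels a node of rank \<open>K\<close> at or below the root, and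
  the part of the derivation between them is an even context sending words of \<open>Y\<close> into
  \<open>X\<close>.\<close>

definition reach :: "nat \<Rightarrow> 'a sym list set \<Rightarrow> 'a sym list \<Rightarrow> 'a sym list set \<Rightarrow> bool" where
  "reach K X w Y \<longleftrightarrow> (\<exists>f u. even_ctx K f \<and> rank_w u = K \<and> u \<in> Y \<and> w = f u \<and>
     (\<forall>y\<in>Y. rank_w y = K \<longrightarrow> f y \<in> X))"

text \<open>Setting of the induction step: \<open>low\<close> is the induction hypothesis for ranks
  below \<open>K\<close>, taken over the enlarged family.\<close>

locale top_rank =
  fixes F :: "'a sym list set set" and K c n :: nat
  assumes fin: "finite F" and hom: "homog F"
    and low: "\<And>X w. der (fill_closure F K (Suc (card F))) c K X w \<Longrightarrow> n < length w \<Longrightarrow> pumpable K n X w"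
begin

text \<open>Heights and stages of fillers stay up to \<open>card F\<close>; the extra stage is there
  because filling with a member of stage \<open>i\<close> leads to stage
  \<open>i + 1\<close>.\<close>

definition F' :: "'a sym list set set" where
  "F' = fill_closure F K (Suc (card F))"

text \<open>Words entering a region have length at most \<open>n\<close>, or at most
  \<open>c\<close> for a leaf; each level of the region at most doubles the length.\<close>

definition bound :: "nat \<Rightarrow> nat" where
  "bound s = 2 ^ s * (n + c)"

abbreviation pump :: "'a sym list set \<Rightarrow> 'a sym list \<Rightarrow> bool" where
  "pump \<equiv> pumpable (Suc K) (bound (Suc (card F)))"

text \<open>A filler \<open>b\<close> can be pushed down from \<open>w\<close> to where its gap was
  created, which leaves only ranks below \<open>K\<close>. Its stage may grow by one per level, and
  \<open>i + s \<le> card F\<close> keeps it within \<open>F'\<close>.\<close>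

definition fillable :: "nat \<Rightarrow> 'a sym list set \<Rightarrow> 'a sym list \<Rightarrow> bool" where
  "fillable s X w \<longleftrightarrow> (\<forall>i j B b. 1 \<le> j \<longrightarrow> j \<le> rank_w w \<longrightarrow> B \<in> fill_closure F K i \<longrightarrow>
     i + s \<le> card F \<longrightarrow> der F' c K B b \<longrightarrow> rank_w b = 0 \<longrightarrow>
     der F' c K (intc_set j X B) (intercal j w b))"

text \<open>The number \<open>s\<close> is the height of the connected region of nodes of rank \<open>K\<close> at the root of
  the derivation of \<open>w\<close>. The languages on a longest path through that region are distinct.\<close>

definition good :: "nat \<Rightarrow> 'a sym list set \<Rightarrow> 'a sym list \<Rightarrow> bool" where
  "good s X w \<longleftrightarrow> X \<in> F \<and> w \<in> X \<and> rank_w w \<le> K \<and> length w \<le> bound s \<and>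
     (\<exists>S\<subseteq>F. card S = s \<and> (\<forall>Y\<in>S. reach K X w Y)) \<and> fillable s X w \<and>
     (rank_w w < K \<longrightarrow> s = 0 \<and> der F' c K X w)"

lemma bound_mono: "s \<le> s' \<Longrightarrow> bound s \<le> bound s'"
  by (simp add: bound_def power_increasing)

lemma bound_Suc: "a \<le> bound s \<Longrightarrow> b \<le> bound s \<Longrightarrow> a + b \<le> bound (Suc s)"
  by (simp add: bound_def)

lemma F_subset: "X \<in> F \<Longrightarrow> X \<in> F'"
  using fill_closure_mono[of 0 "Suc (card F)" F K] unfolding F'_def by auto

lemma closure_subset: "B \<in> fill_closure F K i \<Longrightarrow> i \<le> Suc (card F) \<Longrightarrow> B \<in> F'"
  using fill_closure_mono[of i "Suc (card F)" F K] unfolding F'_def by auto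

lemma rank_eq: "X \<in> F \<Longrightarrow> u \<in> X \<Longrightarrow> v \<in> X \<Longrightarrow> rank_w u = rank_w v"
  using hom unfolding homog_def by blast

lemma rank_eq': "X \<in> F' \<Longrightarrow> u \<in> X \<Longrightarrow> v \<in> X \<Longrightarrow> rank_w u = rank_w v"
  using homog_fill_closure[OF hom] unfolding homog_def F'_def by blast

lemma good_height: "good s X w \<Longrightarrow> s \<le> card F"
  unfolding good_def using card_mono[OF fin] by blast

lemma fillable_mono: "fillable s X w \<Longrightarrow> s \<le> s' \<Longrightarrow> fillable s' X w"
  unfolding fillable_def by (meson add_left_mono order_trans)

lemma fillableD:
  "fillable s X w \<Longrightarrow> 1 \<le> j \<Longrightarrow> j \<le> rank_w w \<Longrightarrow> B \<in> fill_closure F K i \<Longrightarrow> i + s \<le> card F \<Longrightarrow>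
   der F' c K B b \<Longrightarrow> rank_w b = 0 \<Longrightarrow> der F' c K (intc_set j X B) (intercal j w b)"
  unfolding fillable_def by blast

lemma fillable_low:
  assumes "der F' c K X w" "X \<in> F"
  shows "fillable 0 X w"
  unfolding fillable_def
proof (intro allI impI)
  fix i j B b
  assume a: "1 \<le> j" "j \<le> rank_w w" "B \<in> fill_closure F K i" "i + 0 \<le> card F"
    "der F' c K B b" "rank_w b = 0"
  have r: "rank_w w < K" using der_sound assms by blast
  then have "intc_set j X B \<in> F'"
    using intc_set_fill_closure[OF assms(2) a(3), of j] a closure_subset[of _ "Suc i"] by auto
  then show "der F' c K (intc_set j X B) (intercal j w b)"
    by (rule der_intc[OF _ assms(1) a(5)]) (use a r in \<open>auto simp: intc_set_def\<close>)
qed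

text \<open>A word longer than \<open>n\<close> pumps by \<open>low\<close>; a shorter one is a
  possible argument of a region and counts as height \<open>0\<close>.\<close>

lemma good_low:
  assumes "der F' c K X w" "X \<in> F"
  shows "pump X w \<or> good 0 X w"
proof (cases "n < length w")
  case True
  then have "pumpable K n X w" using low assms unfolding F'_def by blast
  moreover have "n \<le> bound 0" by (simp add: bound_def)
  then have "n \<le> bound (Suc (card F))" using bound_mono[OF le0] order_trans by blast
  ultimately show ?thesis using pumpable_mono by (metis le_SucI order_refl)
next
  case False
  have "\<exists>S\<subseteq>F. card S = 0 \<and> (\<forall>Y\<in>S. reach K X w Y)" by (intro exI[of _ "{}"]) auto
  then show ?thesis
    using False der_sound[OF assms(1)] fillable_low[OF assms] assms
    by (auto simp: good_def bound_def)
qed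

text \<open>Adding \<open>X\<close> to the chain of a child gives either a new label or a repetition
  of \<open>X\<close>. In the latter case the composed even context maps \<open>X\<close> to itself
  and lengthens its argument, so it can be pumped.\<close>

lemma reach_Suc:
  assumes X: "X \<in> F" and w: "w \<in> X" "rank_w w = K" "length w \<le> bound (Suc s)"
    and u: "good s Y u"
    and link: "s \<noteq> 0 \<Longrightarrow> \<exists>f. even_ctx K f \<and> w = f u \<and> (\<forall>y\<in>Y. rank_w y = K \<longrightarrow> f y \<in> X)"
    and longer: "s \<noteq> 0 \<Longrightarrow> length u < length w"
  shows "pump X w \<or> (\<exists>S\<subseteq>F. card S = Suc s \<and> (\<forall>Y\<in>S. reach K X w Y))"
proof -
  have id: "reach K X w X"
    unfolding reach_def using even_ctx_id w by blast
  show ?thesis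
  proof (cases "s = 0")
    case True
    then show ?thesis using id X by (intro disjI2 exI[of _ "{X}"]) auto
  next
    case False
    then obtain f where f: "even_ctx K f" "w = f u" "\<And>y. y \<in> Y \<Longrightarrow> rank_w y = K \<Longrightarrow> f y \<in> X"
      using link by blast
    obtain S where S: "S \<subseteq> F" "card S = s" "\<And>Z. Z \<in> S \<Longrightarrow> reach K Y u Z"
      using u unfolding good_def by blast
    have comp: "\<exists>g v. even_ctx K g \<and> rank_w v = K \<and> v \<in> Z \<and> w = g v \<and>
        length v < length w \<and> (\<forall>z\<in>Z. rank_w z = K \<longrightarrow> g z \<in> X)" if Z: "Z \<in> S" for Z
    proof -
      obtain g v where g: "even_ctx K g" "rank_w v = K" "v \<in> Z" "u = g v"
        "\<And>z. z \<in> Z \<Longrightarrow> rank_w z = K \<Longrightarrow> g z \<in> Y"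
        using S(3)[OF Z] unfolding reach_def by blast
      have "length v < length w"
        using even_ctx_length[OF g(1,2)] longer False g(4) by simp
      then show ?thesis
        using even_ctx_comp[OF f(1) g(1)] g f even_ctx_rank[OF g(1)]
        by (intro exI[of _ "\<lambda>w. f (g w)"] exI[of _ v]) auto
    qed
    show ?thesis
    proof (cases "X \<in> S")
      case True
      then obtain g v where g: "even_ctx K g" "rank_w v = K" "v \<in> X" "w = g v"
        "length v < length w" "\<And>z. z \<in> X \<Longrightarrow> rank_w z = K \<Longrightarrow> g z \<in> X"
        using comp by blast
      then have "pumpable (Suc K) (length w) X w"
        using pumpable_even_ctx[of K g v X] by simp
      \<comment> \<open>The pumped part is bounded by all of \<open>w\<close>, which is short
        because the chain of the child has at most \<open>card F\<close> labels.\<close>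
      moreover have "length w \<le> bound (Suc (card F))"
        using w(3) bound_mono[of "Suc s" "Suc (card F)"] good_height[OF u] by simp
      ultimately have "pump X w" by (rule pumpable_mono[OF _ order_refl])
      then show ?thesis ..
    next
      case False
      have "finite S" using S(1) fin finite_subset by blast
      then have "card (insert X S) = Suc s" using S False by simp
      moreover have "reach K X w Z" if "Z \<in> S" for Z
        using comp[OF that] unfolding reach_def by blast
      ultimately show ?thesis using S(1) X id by (intro disjI2 exI[of _ "insert X S"]) auto
    qed
  qed
qed

lemma good_region:
  assumes X: "X \<in> F" and w: "w \<in> X" "rank_w w = K" "length w \<le> length u + length v"
    and u: "good s Y u" and v: "good t Z v"
    and linku: "rank_w u = K \<Longrightarrow> length u < length w \<and>
      (\<exists>f. even_ctx K f \<and> w = f u \<and> (\<forall>y\<in>Y. rank_w y = K \<longrightarrow> f y \<in> X))"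
    and linkv: "rank_w v = K \<Longrightarrow> length v < length w \<and>
      (\<exists>f. even_ctx K f \<and> w = f v \<and> (\<forall>z\<in>Z. rank_w z = K \<longrightarrow> f z \<in> X))"
    and fill: "fillable (Suc (max s t)) X w"
  shows "pump X w \<or> (\<exists>s. good s X w)"
proof -
  \<comment> \<open>Words of rank below \<open>K\<close> have height \<open>0\<close>. The chain is
    continued from the child of greater height, which lies in the region if that height is
    positive.\<close>
  have "s \<noteq> 0 \<Longrightarrow> rank_w u = K" "t \<noteq> 0 \<Longrightarrow> rank_w v = K"
    using u v unfolding good_def by auto
  moreover have "length w \<le> bound (Suc (max s t))"
  proof -
    have "length u \<le> bound (max s t)" "length v \<le> bound (max s t)"
      using u v bound_mono[of s "max s t"] bound_mono[of t "max s t"] unfolding good_def by auto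
    then show ?thesis using w(3) bound_Suc order_trans by blast
  qed
  moreover have "max s t = s \<or> max s t = t" by auto
  ultimately have "pump X w \<or> (\<exists>S\<subseteq>F. card S = Suc (max s t) \<and> (\<forall>Y\<in>S. reach K X w Y))"
    using reach_Suc[OF X w(1,2) _ u] reach_Suc[OF X w(1,2) _ v] linku linkv by metis
  then show ?thesis
    using X w fill \<open>length w \<le> bound (Suc (max s t))\<close> unfolding good_def by blast
qed

section \<open>Pushing fillers down a region\<close>

text \<open>The filler goes to the factor that contains the gap. As this factor has positive rank,
  the other one has rank below \<open>K\<close> and thus a derivation over
  \<open>F'\<close>.\<close>

lemma fillable_conc:
  assumes X: "X \<in> F" and XYZ: "\<forall>y\<in>Y. \<forall>z\<in>Z. y @ z \<in> X"
    and u: "good s Y u" and v: "good t Z v" and r: "rank_w u + rank_w v \<le> K"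
  shows "fillable (Suc (max s t)) X (u @ v)"
  unfolding fillable_def
proof (intro allI impI)
  fix i j B b
  assume a: "1 \<le> j" "j \<le> rank_w (u @ v)" "B \<in> fill_closure F K i" "i + Suc (max s t) \<le> card F"
    "der F' c K B b" "rank_w b = 0"
  have Y: "Y \<in> F" "u \<in> Y" "fillable s Y u" and Z: "Z \<in> F" "v \<in> Z" "fillable t Z v"
    using u v unfolding good_def by auto
  have XB: "intc_set j X B \<in> F'"
    using intc_set_fill_closure[OF X a(3), of j] a r closure_subset[of _ "Suc i"] by auto
  show "der F' c K (intc_set j X B) (intercal j (u @ v) b)"
  proof (cases "j \<le> rank_w u")
    case True
    have "der F' c K (intc_set j Y B) (intercal j u b)"
      using fillableD[OF Y(3) a(1) True a(3) _ a(5,6)] a(4) by simp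
    moreover have "der F' c K Z v"
      using v r True a(1) unfolding good_def by auto
    moreover have "intercal j y x @ z \<in> intc_set j X B" if "y \<in> Y" "x \<in> B" "z \<in> Z" for y x z
    proof -
      have "rank_w y = rank_w u" using rank_eq Y that by blast
      then have "intercal j y x @ z = intercal j (y @ z) x" using True by (simp add: intercal_append)
      then show ?thesis using XYZ that unfolding intc_set_def by blast
    qed
    ultimately have "der F' c K (intc_set j X B) (intercal j u b @ v)"
      using XB rank_w_intercal[of j u b] True a r
      by - (rule der_conc[of _ _ _ _ "intc_set j Y B" _ Z], auto simp: intc_set_def[of j Y])
    then show ?thesis using True by (simp add: intercal_append)
  next
    case False
    let ?j = "j - rank_w u"
    have j: "1 \<le> ?j" "?j \<le> rank_w v" using False a by auto
    have "der F' c K (intc_set ?j Z B) (intercal ?j v b)"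
      using fillableD[OF Z(3) j a(3) _ a(5,6)] a(4) by simp
    moreover have "der F' c K Y u"
      using u r j unfolding good_def by auto
    moreover have "y @ intercal ?j z x \<in> intc_set j X B" if "y \<in> Y" "x \<in> B" "z \<in> Z" for y x z
    proof -
      have "rank_w y = rank_w u" using rank_eq Y that by blast
      then have "y @ intercal ?j z x = intercal j (y @ z) x" using False by (simp add: intercal_append)
      then show ?thesis using XYZ that unfolding intc_set_def by blast
    qed
    ultimately have "der F' c K (intc_set j X B) (u @ intercal ?j v b)"
      using XB rank_w_intercal[of ?j v b] j a r
      by - (rule der_conc[of _ _ _ _ Y _ "intc_set ?j Z B"], auto simp: intc_set_def[of _ Z])
    then show ?thesis using False by (simp add: intercal_append)
  qed
qed

text \<open>The cases follow the three associativity laws. Only a gap inside \<open>v\<close> can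
  force the filler to a higher stage.\<close>

lemma fillable_intc:
  assumes X: "X \<in> F" and XYZ: "\<forall>y\<in>Y. \<forall>z\<in>Z. intercal i y z \<in> X"
    and u: "good s Y u" and v: "good t Z v"
    and i: "1 \<le> i" "i \<le> rank_w u" and r: "rank_w u + rank_w v \<le> Suc K"
  shows "fillable (Suc (max s t)) X (intercal i u v)"
  unfolding fillable_def
proof (intro allI impI)
  fix h j B b
  assume a: "1 \<le> j" "j \<le> rank_w (intercal i u v)" "B \<in> fill_closure F K h"
    "h + Suc (max s t) \<le> card F" "der F' c K B b" "rank_w b = 0"
  have Y: "Y \<in> F" "u \<in> Y" "fillable s Y u" and Z: "Z \<in> F" "v \<in> Z" "fillable t Z v"
    using u v unfolding good_def by auto
  have rw: "Suc (rank_w (intercal i u v)) = rank_w u + rank_w v" using i by (rule rank_w_intercal)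
  have XB: "intc_set j X B \<in> F'"
    using intc_set_fill_closure[OF X a(3), of j] a r rw closure_subset[of _ "Suc h"] by auto
  have BF: "B \<in> F'" "b \<in> B" using der_sound[OF a(5)] by auto
  consider "j < i" | "i \<le> j" "j < i + rank_w v" | "i + rank_w v \<le> j" by linarith
  then show "der F' c K (intc_set j X B) (intercal j (intercal i u v) b)"
  proof cases
    case 1
    have ju: "j \<le> rank_w u" using 1 i by simp
    have "der F' c K (intc_set j Y B) (intercal j u b)"
      using fillableD[OF Y(3) a(1) ju a(3) _ a(5,6)] a(4) by simp
    moreover have "der F' c K Z v"
      using v r 1 i a(1) unfolding good_def by auto
    moreover have "intercal (i - 1) (intercal j y x) z \<in> intc_set j X B"
      if "y \<in> Y" "x \<in> B" "z \<in> Z" for y x z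
    proof -
      \<comment> \<open>The language \<open>B\<close> contains \<open>b\<close> of rank
        \<open>0\<close> and is homogeneous, so all its words have rank \<open>0\<close>, as the
        left law demands.\<close>
      have "rank_w y = rank_w u" "rank_w x = 0" using rank_eq rank_eq' Y BF a(6) that by metis+
      then have "intercal (i - 1) (intercal j y x) z = intercal j (intercal i y z) x"
        using 1 i a(1) by (simp add: intercal_intercal_left)
      then show ?thesis using XYZ that unfolding intc_set_def by blast
    qed
    ultimately have "der F' c K (intc_set j X B) (intercal (i - 1) (intercal j u b) v)"
      using XB rank_w_intercal[of j u b] 1 i ju a r
      by - (rule der_intc[of _ _ _ _ "intc_set j Y B" _ Z], auto simp: intc_set_def[of j Y])
    then show ?thesis using 1 i a by (simp add: intercal_intercal_left)
  next
    case 2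
    let ?j = "Suc j - i"
    have j: "1 \<le> ?j" "?j \<le> rank_w v" using 2 by auto
    have d: "der F' c K (intc_set ?j Z B) (intercal ?j v b)"
      using fillableD[OF Z(3) j a(3) _ a(5,6)] a(4) by simp
    have rv: "Suc (rank_w (intercal ?j v b)) = rank_w v" using rank_w_intercal[OF j, of b] a(6) by simp
    have eq: "intercal i y (intercal ?j z x) \<in> intc_set j X B"
      if "y \<in> Y" "x \<in> B" "z \<in> Z" for y x z
    proof -
      have "rank_w y = rank_w u" "rank_w z = rank_w v" using rank_eq Y Z that by blast+
      then have "intercal i y (intercal ?j z x) = intercal j (intercal i y z) x"
        using 2 i by (simp add: intercal_intercal_inside)
      then show ?thesis using XYZ that unfolding intc_set_def by blast
    qed
    have "der F' c K (intc_set j X B) (intercal i u (intercal ?j v b))"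
    proof (cases "rank_w u < K")
      case True
      then have "der F' c K Y u" using u unfolding good_def by simp
      then show ?thesis using XB d eq i r rv
        by - (rule der_intc[of _ _ _ _ Y _ "intc_set ?j Z B"], auto simp: intc_set_def[of _ Z])
    next
      case False
      \<comment> \<open>Here \<open>u\<close> has rank \<open>K\<close> and cannot be a premise. But
        filling the only gap of \<open>v\<close> gives a word of rank \<open>0\<close>, which serves
        as a new filler for \<open>u\<close>, one stage higher.\<close>
      then have "rank_w v = 1" "rank_w u = K" using r j u unfolding good_def by auto
      then have "?j \<le> K" using j i by simp
      then have B': "intc_set ?j Z B \<in> fill_closure F K (Suc h)"
        by (rule intc_set_fill_closure[OF Z(1) a(3)])
      have "der F' c K (intc_set i Y (intc_set ?j Z B)) (intercal i u (intercal ?j v b))"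
        using fillableD[OF Y(3) i B' _ d] a(4) rv \<open>rank_w v = 1\<close> by simp
      moreover have "intc_set i Y (intc_set ?j Z B) \<subseteq> intc_set j X B"
        using eq unfolding intc_set_def[of i] intc_set_def[of ?j] by blast
      ultimately show ?thesis using XB by (rule der_mono)
    qed
    then show ?thesis using 2 i by (simp add: intercal_intercal_inside)
  next
    case 3
    let ?j = "Suc j - rank_w v"
    have j: "1 \<le> ?j" "i < ?j" "?j \<le> rank_w u" using 3 i a(2) rw by auto
    have "der F' c K (intc_set ?j Y B) (intercal ?j u b)"
      using fillableD[OF Y(3) j(1,3) a(3) _ a(5,6)] a(4) by simp
    moreover have "der F' c K Z v"
      using v r j i unfolding good_def by auto
    moreover have "intercal i (intercal ?j y x) z \<in> intc_set j X B"
      if "y \<in> Y" "x \<in> B" "z \<in> Z" for y x z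
    proof -
      have "rank_w y = rank_w u" "rank_w z = rank_w v" using rank_eq Y Z that by blast+
      then have "intercal i (intercal ?j y x) z = intercal j (intercal i y z) x"
        using 3 i by (simp add: intercal_intercal_right)
      then show ?thesis using XYZ that unfolding intc_set_def by blast
    qed
    ultimately have "der F' c K (intc_set j X B) (intercal i (intercal ?j u b) v)"
      using XB rank_w_intercal[of ?j u b] i j a r
      by - (rule der_intc[of _ _ _ _ "intc_set ?j Y B" _ Z], auto simp: intc_set_def[of _ Y])
    then show ?thesis using 3 i by (simp add: intercal_intercal_right)
  qed
qed

section \<open>Every derived word is pumpable or good\<close>

text \<open>At rank \<open>K\<close> a leaf is a region of height \<open>1\<close>. Only
  \<open>[Sep]\<close> has a gap, and filling it returns the filler, so \<open>B\<close> is included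
  in the filled language.\<close>

lemma good_leaf:
  assumes "X \<in> F" "w \<in> X" "length w \<le> c" "rank_w w = 0 \<or> w = [Sep]" "rank_w w \<le> K"
  shows "pump X w \<or> (\<exists>s. good s X w)"
proof (cases "rank_w w < K")
  case True
  then have "der F' c K X w" using assms F_subset by (auto intro: der.leaf)
  then show ?thesis using good_low assms by blast
next
  case False
  have "fillable 1 X w"
    unfolding fillable_def
  proof (intro allI impI)
    fix i j B b
    assume a: "1 \<le> j" "j \<le> rank_w w" "B \<in> fill_closure F K i" "i + 1 \<le> card F"
      "der F' c K B b" "rank_w b = 0"
    then have w: "w = [Sep]" "j = 1" using assms(4) by auto
    have "intc_set j X B \<in> F'"
      using intc_set_fill_closure[OF assms(1) a(3), of j] a assms(5) closure_subset[of _ "Suc i"] by auto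
    moreover have "B \<subseteq> intc_set j X B"
    proof
      fix x assume "x \<in> B"
      moreover have "x = intercal j w x" using w by simp
      ultimately show "x \<in> intc_set j X B" using assms(2) unfolding intc_set_def by blast
    qed
    ultimately show "der F' c K (intc_set j X B) (intercal j w b)"
      using der_mono[OF a(5)] w by simp
  qed
  moreover have "reach K X w X"
    unfolding reach_def using False assms even_ctx_id by (metis le_neq_implies_less)
  moreover have "length w \<le> bound 1" using assms(3) by (simp add: bound_def)
  ultimately have "good 1 X w" unfolding good_def using False assms
    by (auto intro!: exI[of _ "{X}"])
  then show ?thesis by blast
qed

text \<open>Pumps of a child are inherited. Over good children, a word of rank below
  \<open>K\<close> gets a derivation with ranks below \<open>K\<close>, and a word of rank
  \<open>K\<close> extends their regions.\<close>

lemma pump_or_good: "der F c (Suc K) X w \<Longrightarrow> pump X w \<or> (\<exists>s. good s X w)"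
proof (induction rule: der.induct)
  case (leaf X w)
  then show ?case by (intro good_leaf) auto
next
  case (conc X Y u Z v)
  have uv: "u \<in> Y" "v \<in> Z" using der_sound conc.hyps by blast+
  show ?case
  proof (cases "pump Y u \<or> pump Z v")
    case True
    then show ?thesis
      using pumpable_conc_left[of _ _ Y u v X] pumpable_conc_right[of _ _ Z v u X] uv conc.hyps by blast
  next
    case False
    then obtain s t where u: "good s Y u" and v: "good t Z v" using conc.IH by blast
    show ?thesis
    proof (cases "rank_w u + rank_w v < K")
      case True
      then have "der F' c K Y u" "der F' c K Z v" using u v unfolding good_def by auto
      then have "der F' c K X (u @ v)"
        using conc.hyps True by - (rule der_conc[of _ _ _ _ Y _ Z], auto intro: F_subset)
      then show ?thesis using good_low conc.hyps by blast
    next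
      case False
      then have K: "rank_w (u @ v) = K" using conc.hyps by simp
      show ?thesis
      proof (rule good_region[OF conc.hyps(1) _ K _ u v])
        show "u @ v \<in> X" using uv conc.hyps by blast
        show "fillable (Suc (max s t)) X (u @ v)"
          using conc.hyps K by (intro fillable_conc[OF _ _ u v]) auto
        show "length u < length (u @ v) \<and>
          (\<exists>f. even_ctx K f \<and> u @ v = f u \<and> (\<forall>y\<in>Y. rank_w y = K \<longrightarrow> f y \<in> X))" if "rank_w u = K"
        proof -
          have "rank_w v = 0" using that K by simp
          then obtain x where x: "v = map Sy x" using rank_w_0_iff by blast
          then show ?thesis using even_ctx_append[of K x] uv conc.hyps
            by (intro conjI exI[of _ "\<lambda>w. w @ v"]) auto
        qed
        show "length v < length (u @ v) \<and>
          (\<exists>f. even_ctx K f \<and> u @ v = f v \<and> (\<forall>z\<in>Z. rank_w z = K \<longrightarrow> f z \<in> X))" if "rank_w v = K"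
        proof -
          have "rank_w u = 0" using that K by simp
          then obtain x where x: "u = map Sy x" using rank_w_0_iff by blast
          then show ?thesis using even_ctx_prepend[of K x] uv conc.hyps
            by (intro conjI exI[of _ "\<lambda>w. u @ w"]) auto
        qed
      qed simp
    qed
  qed
next
  case (intc X Y u Z v i)
  have uv: "u \<in> Y" "v \<in> Z" using der_sound intc.hyps by blast+
  have ruv: "rank_w u \<le> K" "rank_w v \<le> K" using der_sound intc.hyps less_Suc_eq_le by blast+
  have i: "1 \<le> i" "i \<le> rank_w u" by fact+
  have rw: "Suc (rank_w (intercal i u v)) = rank_w u + rank_w v" using i by (rule rank_w_intercal)
  have lw: "Suc (length (intercal i u v)) = length u + length v" using i by (rule length_intercal)
  \<comment> \<open>Intercalation adds the lengths and subtracts one, so an argument of length at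
    least \<open>2\<close> makes the result strictly longer than the other argument.\<close>
  have len: "1 < length w" if "1 \<le> rank_w w" "w \<noteq> [Sep]" for w :: "'a sym list"
  proof (cases w)
    case (Cons x xs)
    then show ?thesis using that by (cases x; cases xs) auto
  qed (use that in simp)
  show ?case
  proof (cases "pump Y u \<or> pump Z v")
    case True
    then show ?thesis
      using pumpable_intercal_left[of _ _ Y u i v X] pumpable_intercal_right[of _ _ Z v i u X] uv i intc.hyps
      by blast
  next
    case False
    then obtain s t where u: "good s Y u" and v: "good t Z v" using intc.IH by blast
    show ?thesis
    proof (cases "rank_w (intercal i u v) < K")
      case True
      then have "rank_w v < K" using rw i by simp
      then have dv: "der F' c K Z v" using v unfolding good_def by auto
      have "der F' c K X (intercal i u v)"
      proof (cases "rank_w u < K")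
        case ru: True
        then have "der F' c K Y u" using u unfolding good_def by auto
        then show ?thesis using dv intc.hyps True rw
          by - (rule der_intc[of _ _ _ _ Y _ Z], auto intro: F_subset)
      next
        case ru: False
        then have "rank_w v = 0" using True rw by simp
        \<comment> \<open>The region of \<open>u\<close> is left upwards here: \<open>v\<close> has
          rank \<open>0\<close> and is pushed down into its gap as a filler of stage
          \<open>0\<close>.\<close>
        then have "der F' c K (intc_set i Y Z) (intercal i u v)"
          using u v good_height[OF u] dv i
          by (intro fillableD[of s Y u i Z 0 v]) (auto simp: good_def)
        moreover have "intc_set i Y Z \<subseteq> X" using intc.hyps unfolding intc_set_def by blast
        ultimately show ?thesis using F_subset intc.hyps der_mono by blast
      qed
      then show ?thesis using good_low intc.hyps by blast
    next
      case False
      then have K: "rank_w (intercal i u v) = K" using intc.hyps rw by simp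
      show ?thesis
      proof (rule good_region[OF intc.hyps(1) _ K _ u v])
        show "intercal i u v \<in> X" using uv intc.hyps by blast
        show "length (intercal i u v) \<le> length u + length v" using lw by simp
        show "fillable (Suc (max s t)) X (intercal i u v)"
          using intc.hyps by (intro fillable_intc[OF _ _ u v]) auto
        show "length u < length (intercal i u v) \<and>
          (\<exists>f. even_ctx K f \<and> intercal i u v = f u \<and> (\<forall>y\<in>Y. rank_w y = K \<longrightarrow> f y \<in> X))"
          if "rank_w u = K"
        proof -
          have "rank_w v = 1" using rw K that by simp
          then show ?thesis
            using even_ctx_intercal[of v i K] uv intc.hyps i that lw len[of v]
            by (intro conjI exI[of _ "\<lambda>w. intercal i w v"]) auto
        qed
        show "length v < length (intercal i u v) \<and>
          (\<exists>f. even_ctx K f \<and> intercal i u v = f v \<and> (\<forall>z\<in>Z. rank_w z = K \<longrightarrow> f z \<in> X))"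
          if "rank_w v = K"
        proof -
          have 1: "rank_w u = 1" "i = 1" using rw K that i by auto
          then have "even_ctx K (\<lambda>w. intercal i u w)"
            using even_ctx_intercal_into[of u K] by simp
          moreover have "length v < length (intercal i u v)"
            using 1 lw len[of u] intc.hyps(5) by simp
          ultimately show ?thesis using uv intc.hyps(4) by blast
        qed
      qed
    qed
  qed
qed

lemma pumpable_Suc:
  assumes "der F c (Suc K) X w" "bound (Suc (card F)) < length w"
  shows "pump X w"
proof (rule ccontr)
  assume "\<not> pump X w"
  then obtain s where s: "good s X w" using pump_or_good assms by blast
  then have "length w \<le> bound s" unfolding good_def by blast
  also have "\<dots> \<le> bound (Suc (card F))" using good_height[OF s] by (intro bound_mono) simp
  finally show False using assms by simp
qed

end

text \<open>The induction ranges over all families at once, as the step enlarges the family. For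
  \<open>K = 0\<close> nothing is derivable.\<close>

theorem der_pumpable:
  assumes "finite F" "homog F"
  shows "\<exists>n. \<forall>X w. der F c K X w \<longrightarrow> n < length w \<longrightarrow> pumpable K n X w"
  using assms
proof (induction K arbitrary: F)
  case 0
  have "\<not> der F c 0 X w" for X w using der_sound[of F c 0 X w] by auto
  then show ?case by simp
next
  case (Suc K)
  obtain n where n: "\<forall>X w. der (fill_closure F K (Suc (card F))) c K X w \<longrightarrow> n < length w \<longrightarrow> pumpable K n X w"
    using Suc.IH[OF finite_fill_closure[OF Suc.prems(1)] homog_fill_closure[OF Suc.prems(2)]] by (rule exE)
  interpret top_rank F K c n
    by (rule top_rank.intro[OF Suc.prems n[rule_format]])
  show ?case
    by (intro exI[of _ "bound (Suc (card F))"] allI impI pumpable_Suc)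
qed


section \<open>Displacement context-free grammars\<close>

text \<open>Big-step form of derivability, which dissolves rewriting inside contexts into structural
  rules.\<close>

inductive gen :: "('n \<times> ('n, 'a) tm) set \<Rightarrow> ('n, 'a) tm \<Rightarrow> 'a sym list \<Rightarrow> bool"
  for P where
  NT: "(A, \<alpha>) \<in> P \<Longrightarrow> gen P \<alpha> w \<Longrightarrow> gen P (NT A) w"
| Wd: "gen P (Wd x) (map Sy x)"
| One: "gen P One [Sep]"
| Conc: "gen P a u \<Longrightarrow> gen P b v \<Longrightarrow> gen P (Conc a b) (u @ v)"
| Intc: "gen P a u \<Longrightarrow> gen P b v \<Longrightarrow> gen P (Intc j a b) (intercal j u v)"

lemma gen_ground: "ground a \<Longrightarrow> gen P a (val a)"
  by (induction a) (auto intro: gen.intros)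

lemma gen_step: "step P a b \<Longrightarrow> gen P b w \<Longrightarrow> gen P a w"
proof (induction arbitrary: w rule: step.induct)
  case (concL a a' b)
  from concL.prems show ?case by cases (auto intro: gen.Conc concL.IH)
next
  case (concR b b' a)
  from concR.prems show ?case by cases (auto intro: gen.Conc concR.IH)
next
  case (intcL a a' j b)
  from intcL.prems show ?case by cases (auto intro: gen.Intc intcL.IH)
next
  case (intcR b b' j a)
  from intcR.prems show ?case by cases (auto intro: gen.Intc intcR.IH)
qed (auto intro: gen.NT)

lemma gen_steps: "(step P)\<^sup>*\<^sup>* a b \<Longrightarrow> gen P b w \<Longrightarrow> gen P a w"
  by (induction rule: converse_rtranclp_induct) (auto intro: gen_step)

lemma steps_Conc:
  "(step P)\<^sup>*\<^sup>* a a' \<Longrightarrow> (step P)\<^sup>*\<^sup>* b b' \<Longrightarrow> (step P)\<^sup>*\<^sup>* (Conc a b) (Conc a' b')"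
proof (induction rule: rtranclp_induct)
  case base
  then show ?case by (induction rule: rtranclp_induct) (auto intro: step.concR rtranclp.rtrancl_into_rtrancl)
qed (auto intro: step.concL rtranclp.rtrancl_into_rtrancl)

lemma steps_Intc:
  "(step P)\<^sup>*\<^sup>* a a' \<Longrightarrow> (step P)\<^sup>*\<^sup>* b b' \<Longrightarrow> (step P)\<^sup>*\<^sup>* (Intc j a b) (Intc j a' b')"
proof (induction rule: rtranclp_induct)
  case base
  then show ?case by (induction rule: rtranclp_induct) (auto intro: step.intcR rtranclp.rtrancl_into_rtrancl)
qed (auto intro: step.intcL rtranclp.rtrancl_into_rtrancl)

lemma gen_imp_steps: "gen P a w \<Longrightarrow> \<exists>b. ground b \<and> (step P)\<^sup>*\<^sup>* a b \<and> val b = w"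
proof (induction rule: gen.induct)
  case (NT A \<alpha> w)
  then obtain b where "ground b" "(step P)\<^sup>*\<^sup>* \<alpha> b" "val b = w" by blast
  moreover from this have "(step P)\<^sup>*\<^sup>* (tm.NT A) b"
    using NT.hyps(1) by (auto intro: step.rule converse_rtranclp_into_rtranclp)
  ultimately show ?case by blast
next
  case (Wd x)
  then show ?case by (intro exI[of _ "tm.Wd x"]) auto
next
  case One
  then show ?case by (intro exI[of _ "tm.One"]) auto
next
  case (Conc a u b v)
  then obtain a' b' where "ground a'" "(step P)\<^sup>*\<^sup>* a a'" "val a' = u" "ground b'" "(step P)\<^sup>*\<^sup>* b b'" "val b' = v"
    by blast
  then show ?case using steps_Conc by (intro exI[of _ "tm.Conc a' b'"]) auto
next
  case (Intc a u b v j)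
  then obtain a' b' where "ground a'" "(step P)\<^sup>*\<^sup>* a a'" "val a' = u" "ground b'" "(step P)\<^sup>*\<^sup>* b b'" "val b' = v"
    by blast
  then show ?case using steps_Intc by (intro exI[of _ "tm.Intc j a' b'"]) auto
qed

lemma lang_iff_gen: "w \<in> lang G \<longleftrightarrow> gen (Rules G) (NT (Start G)) (map Sy w)"
proof
  assume "w \<in> lang G"
  then obtain a where "ground a" "(step (Rules G))\<^sup>*\<^sup>* (NT (Start G)) a" "val a = map Sy w"
    unfolding lang_def derives_def by blast
  then show "gen (Rules G) (NT (Start G)) (map Sy w)" using gen_steps gen_ground by metis
next
  assume "gen (Rules G) (NT (Start G)) (map Sy w)"
  then show "w \<in> lang G" using gen_imp_steps unfolding lang_def derives_def by blast
qed

section \<open>From grammars to families of languages\<close>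

fun subterms :: "('n, 'a) tm \<Rightarrow> ('n, 'a) tm set" where
  "subterms (Conc a b) = insert (Conc a b) (subterms a \<union> subterms b)"
| "subterms (Intc j a b) = insert (Intc j a b) (subterms a \<union> subterms b)"
| "subterms a = {a}"

lemma finite_subterms: "finite (subterms a)"
  by (induction a rule: subterms.induct) auto

lemma subterms_refl: "a \<in> subterms a"
  by (cases a) auto

lemma subterms_trans: "b \<in> subterms a \<Longrightarrow> subterms b \<subseteq> subterms a"
  by (induction a rule: subterms.induct) auto

lemma correct_subterms: "correct k N rk a \<Longrightarrow> b \<in> subterms a \<Longrightarrow> correct k N rk b"
  by (induction a rule: subterms.induct) auto

text \<open>In \<open>Intc\<close> the sum of ranks may be \<open>k + 1\<close>, so the left
  argument needs the bound \<open>max k 1\<close>, valid for all correct terms; it equals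
  \<open>k\<close> because \<open>Intc\<close> forces \<open>k\<close> to be positive.\<close>

lemma trk_subterms_le:
  assumes "\<forall>A\<in>N. rk A \<le> k" "correct k N rk a" "trk rk a \<le> k" "b \<in> subterms a"
  shows "trk rk b \<le> k"
proof -
  have *: "trk rk a \<le> max k 1" if "correct k N rk a" for a :: "('a, 'b) tm"
    using that assms(1) by (induction a) force+
  show ?thesis using assms(2-4)
  proof (induction a rule: subterms.induct)
    case (2 j a b)
    then have "trk rk a \<le> k" "trk rk b \<le> k" using *[of a] by auto
    then show ?case using 2 by auto
  qed auto
qed

lemma gen_rank:
  assumes "is_dcfg k G" "gen (Rules G) a w" "correct k (Nts G) (rank G) a"
  shows "rank_w w = trk (rank G) a"
  using assms(2,3)
proof (induction rule: gen.induct)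
  case (NT A \<alpha> w)
  then show ?case using assms(1) unfolding is_dcfg_def by fastforce
next
  case (Intc a u b v j)
  then show ?case using rank_w_intercal[of j u v] by auto
qed auto

text \<open>The languages of the nonterminals and of the subterms of right-hand sides form a finite
  homogeneous family, over which every derivation of the grammar can be imitated.\<close>

lemma dcfg_pumpable:
  assumes G: "is_dcfg k G"
  shows "\<exists>n. \<forall>w. gen (Rules G) (NT (Start G)) w \<longrightarrow> n < length w \<longrightarrow>
    pumpable (Suc k) n (Collect (gen (Rules G) (NT (Start G)))) w"
proof -
  define P where "P = Rules G"
  define L where "L a = Collect (gen P a)" for a
  define Q where "Q = insert (NT (Start G)) ((NT ` Nts G) \<union> (\<Union>(A, \<alpha>)\<in>P. subterms \<alpha>))"
  have finQ: "finite Q"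
    using G unfolding Q_def P_def is_dcfg_def by (auto simp: finite_subterms)
  have rules: "A \<in> Nts G \<and> correct k (Nts G) (rank G) \<alpha> \<and> rank G A = trk (rank G) \<alpha> \<and> rank G A \<le> k"
    if "(A, \<alpha>) \<in> P" for A \<alpha>
    using G that unfolding P_def is_dcfg_def by fastforce
  have Q: "correct k (Nts G) (rank G) a \<and> trk (rank G) a \<le> k" if "a \<in> Q" for a
  proof -
    have N: "Start G \<in> Nts G" "\<forall>A\<in>Nts G. rank G A \<le> k" using G unfolding is_dcfg_def by auto
    from that consider "a = NT (Start G)" | A where "A \<in> Nts G" "a = NT A"
      | A \<alpha> where "(A, \<alpha>) \<in> P" "a \<in> subterms \<alpha>"
      unfolding Q_def by auto
    then show ?thesis
    proof cases
      case 3
      then show ?thesis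
        using rules[OF 3(1)] correct_subterms[of _ _ _ \<alpha> a] trk_subterms_le[OF N(2), of \<alpha> a] by simp
    qed (use N in auto)
  qed
  have sub: "subterms a \<subseteq> Q" if "a \<in> Q" for a
    using that subterms_trans[of a] unfolding Q_def by auto
  have rank: "rank_w w = trk (rank G) a" if "gen P a w" "a \<in> Q" for a w
    using that Q[of a] gen_rank[OF G, of a w] unfolding P_def by simp
  have hom: "homog (L ` Q)"
    unfolding homog_def L_def using rank by auto
  \<comment> \<open>The inserted \<open>1\<close> accommodates the leaf
    \<open>[Sep]\<close>.\<close>
  define c where "c = Max (insert 1 ((\<lambda>a. case a of Wd x \<Rightarrow> length x | _ \<Rightarrow> 0) ` Q))"
  have c: "1 \<le> c" "tm.Wd x \<in> Q \<Longrightarrow> length x \<le> c" for x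
    unfolding c_def using finQ by (auto intro!: Max_ge intro: rev_image_eqI)
  have rank_le: "rank_w w < Suc k" if "gen P a w" "a \<in> Q" for a w
    using rank[OF that] Q[OF that(2)] by simp
  have der: "a \<in> Q \<Longrightarrow> der (L ` Q) c (Suc k) (L a) w" if "gen P a w" for a w
    using that
  proof (induction rule: gen.induct)
    case (NT A \<alpha> w)
    then have "\<alpha> \<in> Q" using subterms_refl[of \<alpha>] unfolding Q_def by auto
    \<comment> \<open>A rule of the grammar turns into an inclusion of languages, so the derivation
      of its body is merely relabelled.\<close>
    moreover have "L \<alpha> \<subseteq> L (tm.NT A)" using NT unfolding L_def by (auto intro: gen.NT)
    ultimately show ?case using NT by (auto intro: der_mono)
  next
    case (Wd x)
    then show ?case using c unfolding L_def by (intro der.leaf) (auto intro: gen.Wd)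
  next
    case One
    then show ?case using c rank_le[OF gen.One] unfolding L_def by (intro der.leaf) (auto intro: gen.One)
  next
    case (Conc a u b v)
    then have "a \<in> Q" "b \<in> Q" using sub[OF Conc.prems] subterms_refl by auto
    then show ?case
      using Conc rank_le[OF gen.Conc] unfolding L_def
      by - (rule der_conc[of _ _ _ _ "L a" _ "L b"], auto simp: L_def intro: gen.Conc)
  next
    case (Intc a u b v j)
    then have ab: "a \<in> Q" "b \<in> Q" using sub[OF Intc.prems] subterms_refl by auto
    then have "rank_w u = trk (rank G) a" "rank_w v = trk (rank G) b"
      using rank Intc.hyps by auto
    then have "1 \<le> j" "j \<le> rank_w u" "rank_w u + rank_w v \<le> Suc k" using Q[OF Intc.prems] by auto
    then show ?case
      using Intc ab unfolding L_def
      by - (rule der_intc[of _ _ _ _ "L a" _ "L b"], auto simp: L_def intro: gen.Intc)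
  qed
  obtain n where "\<forall>X w. der (L ` Q) c (Suc k) X w \<longrightarrow> n < length w \<longrightarrow> pumpable (Suc k) n X w"
    using der_pumpable[OF _ hom] finQ by blast
  moreover have "NT (Start G) \<in> Q" unfolding Q_def by simp
  ultimately show ?thesis using der unfolding L_def P_def by blast
qed

section \<open>Indexed form of the factorization\<close>

lemma concat_map_index: "concat (map (\<lambda>i. f (xs ! (i - 1))) [1..<length xs + 1]) = concat (map f xs)"
proof -
  have "map (\<lambda>i. f (xs ! (i - 1))) [1..<length xs + 1] = map f xs"
    by (rule nth_equalityI) (auto simp del: upt_Suc)
  then show ?thesis by simp
qed

text \<open>The word has no separators, hence neither do the blocks \<open>t\<close> and \<open>s\<close>.\<close>

lemma pumpable_map_Sy:
  assumes "pumpable l n X (map Sy w)"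
  shows "\<exists>l' \<le> l. \<exists>s y u z.
    w = s 0 @ concat (map (\<lambda>i. y i @ u i @ z i @ s i) [1..<l'+1]) \<and>
    length (concat (map (\<lambda>i. y i @ z i) [1..<l'+1])) > 0 \<and>
    length (concat (map (\<lambda>i. y i @ u i @ z i) [1..<l'+1])) \<le> n \<and>
    (\<forall>p::nat. map Sy (s 0 @ concat (map (\<lambda>i. pow p (y i) @ u i @ pow p (z i) @ s i) [1..<l'+1])) \<in> X)"
proof -
  obtain t ps where ps: "length ps \<le> l" "map Sy w = pword 1 t ps"
     "0 < length (concat (map (\<lambda>(y, u, z). y @ z) (triples ps)))"
     "length (concat (map (\<lambda>(y, u, z). y @ u @ z) (triples ps))) \<le> n"
     "\<forall>p. pword p t ps \<in> X"
    using assms unfolding pumpable_def by blast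
  \<comment> \<open>On a separator-free block, \<open>d\<close> picks the preimage under
    \<open>map Sy\<close>.\<close>
  define d where "d = (\<lambda>v :: 'a sym list. SOME x. v = map Sy x)"
  have "rank_w (pword 1 t ps) = 0" using ps(2) by (metis rank_w_simps(5))
  then have "rank_w t = 0 \<and> (\<forall>(y, u, z, s) \<in> set ps. rank_w s = 0)"
  proof (induction ps arbitrary: t)
    case (Cons q ps)
    obtain y u z s where "q = (y, u, z, s)" by (cases q)
    then show ?case using Cons.IH[of s] Cons.prems by auto
  qed simp
  moreover have "map Sy (d v) = v" if "rank_w v = 0" for v
    using someI_ex[of "\<lambda>x. v = map Sy x"] that unfolding d_def rank_w_0_iff by simp
  ultimately have d: "map Sy (d t) = t" "\<And>y u z s. (y, u, z, s) \<in> set ps \<Longrightarrow> map Sy (d s) = s"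
    by auto
  have word: "pword p t ps =
    map Sy (d t @ concat (map (\<lambda>(y, u, z, s). pow p y @ u @ pow p z @ d s) ps))" for p
    using d unfolding pword_def
    by (auto simp: map_concat intro!: arg_cong[of _ _ concat])
  \<comment> \<open>Indices start at \<open>1\<close>, and \<open>?s 0\<close> is the initial block
    \<open>t\<close>.\<close>
  let ?y = "\<lambda>i. fst (ps ! (i - 1))" and ?u = "\<lambda>i. fst (snd (ps ! (i - 1)))"
    and ?z = "\<lambda>i. fst (snd (snd (ps ! (i - 1))))"
    and ?s = "\<lambda>i. if i = 0 then d t else d (snd (snd (snd (ps ! (i - 1)))))"
  have idx: "concat (map g [1..<length ps + 1]) = concat (map f ps)"
    if "\<And>i. 1 \<le> i \<Longrightarrow> g i = f (ps ! (i - 1))" for f :: "_ \<Rightarrow> 'a list" and g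
  proof -
    have "map g [1..<length ps + 1] = map (\<lambda>i. f (ps ! (i - 1))) [1..<length ps + 1]"
      using that by (intro map_cong) auto
    then show ?thesis by (simp only: concat_map_index)
  qed
  have pumped: "pword p t ps = map Sy (?s 0 @
    concat (map (\<lambda>i. pow p (?y i) @ ?u i @ pow p (?z i) @ ?s i) [1..<length ps + 1]))" for p
    unfolding word by (subst idx[where f = "\<lambda>(y, u, z, s). pow p y @ u @ pow p z @ d s"]) (auto split: prod.split)
  have "w = ?s 0 @ concat (map (\<lambda>i. ?y i @ ?u i @ ?z i @ ?s i) [1..<length ps + 1])"
  proof (rule map_injective[of Sy])
    show "map Sy w = map Sy (?s 0 @ concat (map (\<lambda>i. ?y i @ ?u i @ ?z i @ ?s i) [1..<length ps + 1]))"
      using ps(2) pumped[of 1] by (simp del: upt_Suc)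
  qed (simp add: inj_def)
  moreover have "concat (map (\<lambda>i. ?y i @ ?z i) [1..<length ps + 1]) =
      concat (map (\<lambda>(y, u, z). y @ z) (triples ps))"
    by (subst idx[where f = "\<lambda>(y, u, z, s). y @ z"]) (auto split: prod.split intro!: arg_cong[of _ _ concat])
  moreover have "concat (map (\<lambda>i. ?y i @ ?u i @ ?z i) [1..<length ps + 1]) =
      concat (map (\<lambda>(y, u, z). y @ u @ z) (triples ps))"
    by (subst idx[where f = "\<lambda>(y, u, z, s). y @ u @ z"]) (auto split: prod.split intro!: arg_cong[of _ _ concat])
  ultimately show ?thesis
    using ps pumped
    by - (rule exI[of _ "length ps"], rule conjI, assumption, rule exI[of _ ?s], rule exI[of _ ?y],
      rule exI[of _ ?u], rule exI[of _ ?z], simp del: upt_Suc)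
qed

theorem theorem3:
  fixes G :: "('n, 'a) dcfg" and k :: nat
  assumes "is_dcfg k G"
  shows "\<exists>n. \<forall>w \<in> lang G. length w > n \<longrightarrow>
    (\<exists>l \<le> k + 1. \<exists>s y u z :: nat \<Rightarrow> 'a list.
       w = s 0 @ concat (map (\<lambda>i. y i @ u i @ z i @ s i) [1..<l+1]) \<and>
       length (concat (map (\<lambda>i. y i @ z i) [1..<l+1])) > 0 \<and>
       length (concat (map (\<lambda>i. y i @ u i @ z i) [1..<l+1])) \<le> n \<and>
       (\<forall>p::nat. s 0 @ concat (map (\<lambda>i. concat (replicate p (y i)) @ u i @
                   concat (replicate p (z i)) @ s i) [1..<l+1]) \<in> lang G))"
proof -
  obtain n where n: "\<And>w. gen (Rules G) (NT (Start G)) w \<Longrightarrow> n < length w \<Longrightarrow>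
    pumpable (k + 1) n (Collect (gen (Rules G) (NT (Start G)))) w"
    using dcfg_pumpable[OF assms] by auto
  show ?thesis
  proof (rule exI[of _ n], intro ballI impI)
    fix w assume "w \<in> lang G" "n < length w"
    then have "pumpable (k + 1) n (Collect (gen (Rules G) (NT (Start G)))) (map Sy w)"
      using n[of "map Sy w"] by (simp add: lang_iff_gen)
    from pumpable_map_Sy[OF this]
    show "\<exists>l \<le> k + 1. \<exists>s y u z :: nat \<Rightarrow> 'a list.
       w = s 0 @ concat (map (\<lambda>i. y i @ u i @ z i @ s i) [1..<l+1]) \<and>
       length (concat (map (\<lambda>i. y i @ z i) [1..<l+1])) > 0 \<and>
       length (concat (map (\<lambda>i. y i @ u i @ z i) [1..<l+1])) \<le> n \<and>
       (\<forall>p::nat. s 0 @ concat (map (\<lambda>i. concat (replicate p (y i)) @ u i @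
                   concat (replicate p (z i)) @ s i) [1..<l+1]) \<in> lang G)"
      unfolding lang_iff_gen mem_Collect_eq .
  qed
qed

end
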